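(* Let $\rho = \frac{1}{1000}$. For every $\epsilon > 0$ there exists $n_0(\epsilon)$ such that for all $n \geq n_0(\epsilon)$ the following holds. Let $G$ be a graph on $n$ vertices with at least $n^{2 - \rho}$ edges. If $\mathsf{sp}(G) \leq n^{1 + \rho}$, then $G$ contains an induced subgraph $H$ on at least $n^{1 - 4\rho}$ vertices with edge density at least $1 - \epsilon$.
   Context: Graphs are finite, simple and undirected. For a graph $G$ with $m$ edges, $\mathsf{mc}(G)$ is the largest number of edges in a bipartite subgraph of $G$, and the surplus is $\mathsf{sp}(G) = \mathsf{mc}(G) - \frac{m}{2}$. The edge density of a graph with $n$ vertices and $m$ edges is $p = \frac{2m}{n^2}$. *)

theory Defs
  imports Complex_Main
begin

text \<open>A finite simple undirected graph is given by its vertex set \<open>V\<close> and its edge set \<open>E\<close>,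
  each edge being an unordered pair of distinct vertices.\<close>

definition simple_graph :: "'a set \<Rightarrow> 'a set set \<Rightarrow> bool" where
  "simple_graph V E \<longleftrightarrow> finite V \<and> (\<forall>e\<in>E. \<exists>u\<in>V. \<exists>v\<in>V. u \<noteq> v \<and> e = {u, v})"

definition subgraph :: "'a set \<Rightarrow> 'a set set \<Rightarrow> 'a set \<Rightarrow> 'a set set \<Rightarrow> bool" where
  "subgraph W F V E \<longleftrightarrow> simple_graph W F \<and> W \<subseteq> V \<and> F \<subseteq> E"

definition induced_subgraph :: "'a set \<Rightarrow> 'a set set \<Rightarrow> 'a set \<Rightarrow> 'a set set \<Rightarrow> bool" where
  "induced_subgraph W F V E \<longleftrightarrow> W \<subseteq> V \<and> F = {e \<in> E. e \<subseteq> W}"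

definition bipartite :: "'a set \<Rightarrow> 'a set set \<Rightarrow> bool" where
  "bipartite V E \<longleftrightarrow>
     (\<exists>A B. A \<union> B = V \<and> A \<inter> B = {} \<and> (\<forall>e\<in>E. \<exists>a\<in>A. \<exists>b\<in>B. e = {a, b}))"

definition mc :: "'a set \<Rightarrow> 'a set set \<Rightarrow> nat" where
  "mc V E = Max {card F | W F. subgraph W F V E \<and> bipartite W F}"

definition sp :: "'a set \<Rightarrow> 'a set set \<Rightarrow> real" where
  "sp V E = real (mc V E) - real (card E) / 2"

definition edge_density :: "'a set \<Rightarrow> 'a set set \<Rightarrow> real" where
  "edge_density V E = 2 * real (card E) / (real (card V))\<^sup>2"

lemma simple_graph_finite_edges: "simple_graph V E \<Longrightarrow> finite E"
  unfolding simple_graph_def by (rule finite_subset[of E "Pow V"]) auto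

text \<open>On finite graphs the maximum in the definition of \<open>mc\<close> is taken over a finite non-empty set.\<close>

lemma mc_set_finite_nonempty:
  assumes "simple_graph V E"
  shows "finite {card F | W F. subgraph W F V E \<and> bipartite W F}"
    and "{card F | W F. subgraph W F V E \<and> bipartite W F} \<noteq> {}"
proof -
  have "finite (Pow E)" using simple_graph_finite_edges[OF assms] by simp
  then show "finite {card F | W F. subgraph W F V E \<and> bipartite W F}"
    by (rule finite_surj[where f = card]) (auto simp: subgraph_def)
  have "subgraph {} {} V E \<and> bipartite {} {}"
    by (simp add: subgraph_def simple_graph_def bipartite_def)
  then show "{card F | W F. subgraph W F V E \<and> bipartite W F} \<noteq> {}" by blast
qed

end

theory Submission
  imports Defs "HOL-Analysis.Analysis" "HOL-Real_Asymp.Real_Asymp"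
begin

text \<open>
  Write \<open>A\<close> for the adjacency matrix and put \<open>l = 8 n\<^bsup>2\<rho>\<^esup>\<close>. A small surplus forces \<open>A + l I\<close> to be positive
  semidefinite after deleting few vertices. Among the remaining vertex sets choose \<open>S\<close> maximising
  \<open>e(S)\<^bsup>4\<^esup> / |S|\<^bsup>7\<^esup>\<close>, so that \<open>|S| \<ge> n\<^bsup>1 - 4\<rho>\<^esup>\<close>, all degrees in \<open>S\<close> are at least about 7/8 of the
  average, and no neighbourhood in \<open>S\<close> is much denser than \<open>S\<close> itself.

  Let \<open>\<sigma>(R)\<close> be the sum of the \<open>R\<close> largest eigenvalues of \<open>A\<close> on \<open>S\<close>, divided by \<open>s = |S|\<close>. Because \<open>A\<close>
  is a 0/1 matrix, the Hadamard square of \<open>A + l I\<close> is \<open>A + l\<^sup>2 I\<close>; compressing to the top eigenspaces,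
  this gives \<open>\<sigma>(R)\<^sup>2 \<le> \<sigma>(R\<^sup>2) + l\<^sup>2 R\<^sup>2 / s\<close>. Iterating from the trivial bound \<open>\<sigma>(R) \<le> l\<close> yields
  \<open>\<sigma>(R) \<le> (1 + o(1)) (2R)\<^bsup>\<eta>\<^esup>\<close> with a tiny \<open>\<eta>\<close>, so the spectrum is concentrated on few eigenvalues whose
  sum is barely larger than \<open>s\<close>. Then typical neighbourhoods are almost complete, and by extremality
  of \<open>S\<close> its density is at least 0.72.

  Finally, let \<open>d\<close> be the degree vector shifted by \<open>l\<close> and \<open>T\<close> its sum. Then \<open>A + l I - d d\<^sup>T / T\<close> is positive
  semidefinite, hence so is its 13th Hadamard power. With \<open>\<beta>\<close> an entry of \<open>d d\<^sup>T / T\<close>, which is at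
  least 0.54, an edge contributes \<open>(1 - \<beta>)\<^bsup>13\<^esup>\<close> and a non-edge \<open>- \<beta>\<^bsup>13\<^esup>\<close> to the sum of the entries, which
  leaves room for only few non-edges.
\<close>

section \<open>Spectral theorem\<close>

text \<open>Tychonoff: the box is a product of compact sets. Pinning functions to 0 off
  \<open>V\<close> gives compactness in the product topology even over an infinite type, so that
  vectors and matrices can be plain functions in the maximisation arguments.\<close>

lemma compact_unit_box:
  fixes V :: "'b set"
  shows "compact {x :: 'b \<Rightarrow> real. \<forall>i. (i \<in> V \<longrightarrow> -1 \<le> x i \<and> x i \<le> 1) \<and> (i \<notin> V \<longrightarrow> x i = 0)}"
    (is "compact ?B")
proof -
  have "?B = PiE UNIV (\<lambda>i. if i \<in> V then {-1..1} else {0})"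
    by (auto simp: PiE_iff split: if_splits)
  moreover have "compactin (product_topology (\<lambda>i. euclidean) UNIV)
      (PiE UNIV (\<lambda>i. if i \<in> V then {-1..1::real} else {0}))"
    unfolding compactin_PiE by auto
  ultimately show ?thesis
    by (simp add: euclidean_product_topology)
qed

text \<open>Jacobi's argument: an orthogonal matrix maximising the sum of the squared diagonal entries of the
  conjugate of \<open>A\<close> diagonalises \<open>A\<close>, since otherwise a plane rotation would increase that sum.\<close>

theorem spectral_decomposition:
  fixes A :: "'a \<Rightarrow> 'a \<Rightarrow> real"
  assumes fin: "finite V" and sym: "\<And>x y. x \<in> V \<Longrightarrow> y \<in> V \<Longrightarrow> A x y = A y x"
  obtains \<phi> :: "'a \<Rightarrow> 'a \<Rightarrow> real" and \<alpha> :: "'a \<Rightarrow> real" where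
    "\<And>i j. i \<in> V \<Longrightarrow> j \<in> V \<Longrightarrow> (\<Sum>x\<in>V. \<phi> i x * \<phi> j x) = of_bool (i = j)"
    "\<And>x y. x \<in> V \<Longrightarrow> y \<in> V \<Longrightarrow> (\<Sum>i\<in>V. \<phi> i x * \<phi> i y) = of_bool (x = y)"
    "\<And>i x. i \<in> V \<Longrightarrow> x \<in> V \<Longrightarrow> (\<Sum>y\<in>V. A x y * \<phi> i y) = \<alpha> i * \<phi> i x"
proof -
  define ip where "ip f g = (\<Sum>x\<in>V. f x * g x)" for f g :: "'a \<Rightarrow> real"
  define bf where "bf f g = (\<Sum>x\<in>V. \<Sum>y\<in>V. A x y * f x * g y)" for f g :: "'a \<Rightarrow> real"
  define B where "B = {q :: 'a \<times> 'a \<Rightarrow> real. \<forall>i. (i \<in> V \<times> V \<longrightarrow> -1 \<le> q i \<and> q i \<le> 1) \<and> (i \<notin> V \<times> V \<longrightarrow> q i = 0)}"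
  \<comment> \<open>Orthonormality of rows and of columns is imposed at once, so completeness of the
    maximiser needs no dimension count.\<close>
  define orth where "orth q \<longleftrightarrow> (\<forall>i\<in>V. \<forall>j\<in>V. ip (\<lambda>x. q (i,x)) (\<lambda>x. q (j,x)) = of_bool (i = j)) \<and>
      (\<forall>x\<in>V. \<forall>y\<in>V. (\<Sum>i\<in>V. q (i,x) * q (i,y)) = of_bool (x = y))" for q :: "'a \<times> 'a \<Rightarrow> real"
  define f where "f q = (\<Sum>i\<in>V. (bf (\<lambda>x. q (i,x)) (\<lambda>x. q (i,x)))\<^sup>2)" for q :: "'a \<times> 'a \<Rightarrow> real"
  have coord: "continuous_on S (\<lambda>q :: 'a \<times> 'a \<Rightarrow> real. q k)" for k S
    by (rule continuous_on_subset[OF continuous_on_product_coordinates]) simp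
  have "compact B" unfolding B_def by (rule compact_unit_box)
  moreover have "closed {q. orth q}"
    unfolding orth_def ip_def Ball_def
    by (intro closed_Collect_conj closed_Collect_all closed_Collect_imp open_Collect_const closed_Collect_eq
      continuous_intros coord) 
  ultimately have cpt: "compact (B \<inter> {q. orth q})" by (rule compact_Int_closed)
  define q0 where "q0 = (\<lambda>(i::'a,x). if i \<in> V \<and> x \<in> V \<and> i = x then 1 else (0::real))"
  have q0: "q0 \<in> B \<inter> {q. orth q}"
  proof -
    have "(\<Sum>x\<in>V. q0 (i,x) * q0 (j,x)) = of_bool (i = j)" if "i \<in> V" "j \<in> V" for i j
    proof -
      have "(\<Sum>x\<in>V. q0 (i,x) * q0 (j,x)) = (\<Sum>x\<in>V. if x = i then of_bool (i = j) else 0)"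
        by (rule sum.cong) (auto simp: q0_def)
      then show ?thesis using that fin by simp
    qed
    moreover have "q0 (i,x) = q0 (x,i)" for i x by (auto simp: q0_def)
    ultimately have "orth q0" unfolding orth_def ip_def by simp
    moreover have "q0 \<in> B" by (auto simp: B_def q0_def)
    ultimately show ?thesis by simp
  qed
  have "continuous_on (B \<inter> {q. orth q}) f"
    unfolding f_def bf_def by (intro continuous_intros coord)
  then obtain q where q: "q \<in> B" "orth q" and qmax: "\<And>q'. q' \<in> B \<Longrightarrow> orth q' \<Longrightarrow> f q' \<le> f q"
    using continuous_attains_sup[OF cpt, of f] q0 by blast
  define \<phi> where "\<phi> = (\<lambda>i x. q (i,x))"
  have on: "ip (\<phi> i) (\<phi> j) = of_bool (i = j)" if "i \<in> V" "j \<in> V" for i j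
    using q(2) that by (simp add: orth_def \<phi>_def)
  have co: "(\<Sum>i\<in>V. \<phi> i x * \<phi> i y) = of_bool (x = y)" if "x \<in> V" "y \<in> V" for x y
    using q(2) that by (simp add: orth_def \<phi>_def)
  have ip_lin: "ip (\<lambda>x. a * u x + b * v x) w = a * ip u w + b * ip v w"
      "ip w (\<lambda>x. a * u x + b * v x) = a * ip w u + b * ip w v" for a b u v w
    by (simp_all add: ip_def sum_distrib_left flip: sum.distrib) (simp_all add: algebra_simps)
  have bf_lin: "bf (\<lambda>x. a * u x + b * v x) w = a * bf u w + b * bf v w"
      "bf w (\<lambda>x. a * u x + b * v x) = a * bf w u + b * bf w v" for a b u v w
    by (simp_all add: bf_def sum_distrib_left flip: sum.distrib) (simp_all add: algebra_simps)
  have bf_sym: "bf u v = bf v u" for u v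
    unfolding bf_def by (subst sum.swap) (auto intro!: sum.cong simp: sym)
  have offdiag: "bf (\<phi> i) (\<phi> j) = 0" if ij: "i \<in> V" "j \<in> V" "i \<noteq> j" for i j
  proof (rule ccontr)
    define a b w where "a = bf (\<phi> i) (\<phi> i)" and "b = bf (\<phi> j) (\<phi> j)" and "w = bf (\<phi> i) (\<phi> j)"
    assume "bf (\<phi> i) (\<phi> j) \<noteq> 0"
    then have w: "w \<noteq> 0" by (simp add: w_def)
    \<comment> \<open>The vector \<open>(a - b, 2 * w)\<close> has length \<open>R\<close> and angle
      \<open>t\<close>; rotating by \<open>t/2\<close> diagonalises the 2x2 block with diagonal
      \<open>a\<close>, \<open>b\<close> and off-diagonal entry \<open>w\<close>.\<close>
    define R where "R = sqrt ((a - b)\<^sup>2 + (2 * w)\<^sup>2)"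
    have R2: "R\<^sup>2 = (a - b)\<^sup>2 + (2 * w)\<^sup>2" unfolding R_def by simp
    have R0: "R > 0" using w by (simp add: R_def add_nonneg_pos)
    have "((a - b) / R)\<^sup>2 + (2 * w / R)\<^sup>2 = 1"
      unfolding power_divide add_divide_distrib[symmetric] R2[symmetric] using R0 by simp
    then obtain t where t: "(a - b) / R = cos t" "2 * w / R = sin t"
      using sincos_total_2pi by metis
    define c s where "c = cos (t/2)" and "s = sin (t/2)"
    have cs: "c\<^sup>2 + s\<^sup>2 = 1" unfolding c_def s_def by simp
    have cd: "c\<^sup>2 - s\<^sup>2 = (a - b) / R" using t(1) cos_double[of "t/2"] by (simp add: c_def s_def)
    have sd: "2 * (c * s) = 2 * w / R" using t(2) sin_double[of "t/2"] by (simp add: c_def s_def)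
    \<comment> \<open>\<open>m\<close> hides the minus sign, so that the rotated vector keeps the
      shape to which \<open>ip_lin\<close> and \<open>bf_lin\<close> apply.\<close>
    obtain m where m: "m = - s" by simp
    define \<psi> where "\<psi> k = (if k = i then (\<lambda>x. c * \<phi> i x + s * \<phi> j x)
        else if k = j then (\<lambda>x. m * \<phi> i x + c * \<phi> j x) else \<phi> k)" for k
    define q' where "q' = (\<lambda>(k,x). \<psi> k x)"
    have on': "ip (\<psi> k) (\<psi> l) = of_bool (k = l)" if "k \<in> V" "l \<in> V" for k l
    proof -
      have "of_bool (k = l) = c * c + s * s" if "k = l" using that cs by (simp add: power2_eq_square)
      then show ?thesis using that ij unfolding \<psi>_def
        by (auto simp: ip_lin on) (simp_all add: m)
    qed
    have split: "(\<Sum>k\<in>V. g k) = g i + g j + (\<Sum>k\<in>V - {i,j}. g k)" for g :: "'a \<Rightarrow> real"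
    proof -
      have "(\<Sum>k\<in>V. g k) = (\<Sum>k\<in>{i,j}. g k) + (\<Sum>k\<in>V - {i,j}. g k)"
        using ij fin by (metis (no_types) add.commute empty_subsetI insert_subset sum.subset_diff)
      then show ?thesis using ij by simp
    qed
    have co': "(\<Sum>k\<in>V. \<psi> k x * \<psi> k y) = of_bool (x = y)" if "x \<in> V" "y \<in> V" for x y
    proof -
      have "\<psi> i x * \<psi> i y + \<psi> j x * \<psi> j y = (c\<^sup>2 + s\<^sup>2) * (\<phi> i x * \<phi> i y + \<phi> j x * \<phi> j y)"
        using ij by (simp add: \<psi>_def m algebra_simps power2_eq_square)
      moreover have "(\<Sum>k\<in>V - {i,j}. \<psi> k x * \<psi> k y) = (\<Sum>k\<in>V - {i,j}. \<phi> k x * \<phi> k y)"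
        by (rule sum.cong) (auto simp: \<psi>_def)
      ultimately have "(\<Sum>k\<in>V. \<psi> k x * \<psi> k y) = (\<Sum>k\<in>V. \<phi> k x * \<phi> k y)"
        unfolding split[of "\<lambda>k. \<psi> k x * \<psi> k y"] split[of "\<lambda>k. \<phi> k x * \<phi> k y"] by (simp add: cs)
      then show ?thesis using co that by simp
    qed
    have "orth q'" using on' co' by (simp add: orth_def q'_def)
    moreover have "q' \<in> B"
    proof -
      have "(\<psi> k x)\<^sup>2 \<le> 1" if "k \<in> V" "x \<in> V" for k x
      proof -
        have "(\<psi> k x)\<^sup>2 \<le> (\<Sum>x\<in>V. \<psi> k x * \<psi> k x)"
          using member_le_sum[of x V "\<lambda>x. \<psi> k x * \<psi> k x"] that fin by (simp add: power2_eq_square)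
        then show ?thesis using on'[OF that(1) that(1)] by (simp add: ip_def)
      qed
      then have "-1 \<le> \<psi> k x \<and> \<psi> k x \<le> 1" if "k \<in> V" "x \<in> V" for k x
        using that abs_square_le_1[of "\<psi> k x"] by (simp add: abs_le_iff minus_le_iff)
      moreover have "\<psi> k x = 0" if "k \<notin> V \<or> x \<notin> V" for k x
        using that q(1) ij by (auto simp: \<psi>_def \<phi>_def B_def)
      ultimately show ?thesis by (auto simp: B_def q'_def)
    qed
    ultimately have le: "f q' \<le> f q" using qmax by blast
    define a' b' where "a' = bf (\<psi> i) (\<psi> i)" and "b' = bf (\<psi> j) (\<psi> j)"
    have a': "a' = c\<^sup>2 * a + 2 * (c * s) * w + s\<^sup>2 * b"
      using bf_sym[of "\<phi> i" "\<phi> j"] by (simp add: a'_def \<psi>_def bf_lin a_def b_def w_def algebra_simps power2_eq_square)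
    have b': "b' = s\<^sup>2 * a - 2 * (c * s) * w + c\<^sup>2 * b"
      using bf_sym[of "\<phi> i" "\<phi> j"] ij
      by (simp add: b'_def \<psi>_def bf_lin a_def b_def w_def) (simp add: m algebra_simps power2_eq_square)
    have "a' + b' = (c\<^sup>2 + s\<^sup>2) * (a + b)" unfolding a' b' by (simp add: algebra_simps)
    then have sum': "a' + b' = a + b" by (simp add: cs)
    have "a' - b' = (c\<^sup>2 - s\<^sup>2) * (a - b) + (2 * (c * s)) * (2 * w)" unfolding a' b' by (simp add: algebra_simps)
    also have "\<dots> = R\<^sup>2 / R" unfolding cd sd R2 by (simp add: power2_eq_square add_divide_distrib)
    finally have diff': "a' - b' = R" by (simp add: power2_eq_square)
    \<comment> \<open>The block keeps its trace, while the squared difference of its diagonal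
      entries rises from \<open>(a - b)\<^sup>2\<close> to \<open>R\<^sup>2\<close>; hence the sum
      of their squares rises, against maximality.\<close>
    have par: "u\<^sup>2 + v\<^sup>2 = ((u + v)\<^sup>2 + (u - v)\<^sup>2) / 2" for u v :: real
      by (simp add: power2_eq_square algebra_simps)
    have "a'\<^sup>2 + b'\<^sup>2 > a\<^sup>2 + b\<^sup>2"
      unfolding par[of a' b'] par[of a b] sum' diff' R2 using w by simp
    moreover have "(\<Sum>k\<in>V - {i,j}. (bf (\<psi> k) (\<psi> k))\<^sup>2) = (\<Sum>k\<in>V - {i,j}. (bf (\<phi> k) (\<phi> k))\<^sup>2)"
      by (rule sum.cong) (auto simp: \<psi>_def)
    moreover have "f q' = (\<Sum>k\<in>V. (bf (\<psi> k) (\<psi> k))\<^sup>2)" "f q = (\<Sum>k\<in>V. (bf (\<phi> k) (\<phi> k))\<^sup>2)"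
      by (simp_all add: f_def q'_def \<phi>_def)
    ultimately show False using le
      unfolding split[of "\<lambda>k. (bf (\<psi> k) (\<psi> k))\<^sup>2"] split[of "\<lambda>k. (bf (\<phi> k) (\<phi> k))\<^sup>2"]
      by (simp add: a_def b_def a'_def b'_def)
  qed
  define \<alpha> where "\<alpha> i = bf (\<phi> i) (\<phi> i)" for i
  have "(\<Sum>y\<in>V. A x y * \<phi> i y) = \<alpha> i * \<phi> i x" if "i \<in> V" "x \<in> V" for i x
  proof -
    \<comment> \<open>Completeness expands the image of \<open>\<phi> i\<close> under
      \<open>A\<close> in the basis; by \<open>offdiag\<close> only the component along
      \<open>\<phi> i\<close> survives.\<close>
    define h where "h z = (\<Sum>y\<in>V. A z y * \<phi> i y)" for z
    have "h x = (\<Sum>z\<in>V. of_bool (x = z) * h z)"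
    proof -
      have "(\<Sum>z\<in>V. of_bool (x = z) * h z) = (\<Sum>z\<in>V. if z = x then h x else 0)"
        by (rule sum.cong) auto
      then show ?thesis using that fin by simp
    qed
    also have "\<dots> = (\<Sum>z\<in>V. (\<Sum>k\<in>V. \<phi> k x * \<phi> k z) * h z)"
      using co that by (intro sum.cong) auto
    also have "\<dots> = (\<Sum>k\<in>V. \<phi> k x * (\<Sum>z\<in>V. \<phi> k z * h z))"
      unfolding sum_distrib_right sum_distrib_left by (subst sum.swap) (simp add: mult.assoc)
    also have "\<dots> = (\<Sum>k\<in>V. \<phi> k x * bf (\<phi> k) (\<phi> i))"
      by (simp add: bf_def h_def sum_distrib_left mult_ac)
    also have "\<dots> = (\<Sum>k\<in>V. if k = i then \<phi> i x * \<alpha> i else 0)"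
      using offdiag that by (intro sum.cong) (auto simp: \<alpha>_def)
    also have "\<dots> = \<alpha> i * \<phi> i x" using that fin by simp
    finally show ?thesis by (simp add: h_def)
  qed
  then show ?thesis using that[of \<phi> \<alpha>] on co by (simp add: ip_def)
qed

section \<open>Eigenbases and Schur products\<close>

definition psd_on :: "'a set \<Rightarrow> ('a \<Rightarrow> 'a \<Rightarrow> real) \<Rightarrow> bool" where
  "psd_on V M \<longleftrightarrow> (\<forall>y. 0 \<le> (\<Sum>x\<in>V. \<Sum>z\<in>V. M x z * y x * y z))"

lemma sum_rotate:
  "(\<Sum>x\<in>X. \<Sum>z\<in>Z. \<Sum>i\<in>I. F i x z) = (\<Sum>i\<in>I. \<Sum>x\<in>X. \<Sum>z\<in>Z. F i x z)"
  for F :: "'c \<Rightarrow> 'd \<Rightarrow> 'e \<Rightarrow> real"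
proof -
  have "(\<Sum>x\<in>X. \<Sum>z\<in>Z. \<Sum>i\<in>I. F i x z) = (\<Sum>x\<in>X. \<Sum>i\<in>I. \<Sum>z\<in>Z. F i x z)"
    by (intro sum.cong refl sum.swap)
  also have "\<dots> = (\<Sum>i\<in>I. \<Sum>x\<in>X. \<Sum>z\<in>Z. F i x z)" by (rule sum.swap)
  finally show ?thesis .
qed

text \<open>Eigenvectors are indexed by the points of \<open>V\<close> themselves: their number is
  right automatically and no order of the eigenvalues is fixed.\<close>

locale eigenbasis =
  fixes V :: "'a set" and A :: "'a \<Rightarrow> 'a \<Rightarrow> real" and \<phi> :: "'a \<Rightarrow> 'a \<Rightarrow> real" and \<alpha> :: "'a \<Rightarrow> real"
  assumes fin: "finite V"
    and orthonormal: "\<And>i j. i \<in> V \<Longrightarrow> j \<in> V \<Longrightarrow> (\<Sum>x\<in>V. \<phi> i x * \<phi> j x) = of_bool (i = j)"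
    and complete: "\<And>x y. x \<in> V \<Longrightarrow> y \<in> V \<Longrightarrow> (\<Sum>i\<in>V. \<phi> i x * \<phi> i y) = of_bool (x = y)"
    and eigen: "\<And>i x. i \<in> V \<Longrightarrow> x \<in> V \<Longrightarrow> (\<Sum>y\<in>V. A x y * \<phi> i y) = \<alpha> i * \<phi> i x"
begin

lemma sum_delta': "x \<in> V \<Longrightarrow> (\<Sum>z\<in>V. of_bool (x = z) * h z) = h x" for h :: "'a \<Rightarrow> real"
proof -
  assume "x \<in> V"
  have "(\<Sum>z\<in>V. of_bool (x = z) * h z) = (\<Sum>z\<in>V. if z = x then h x else 0)"
    by (rule sum.cong) auto
  then show ?thesis using \<open>x \<in> V\<close> fin by simp
qed

lemma expand: 
  assumes "x \<in> V" "y \<in> V" shows "A x y = (\<Sum>i\<in>V. \<alpha> i * \<phi> i x * \<phi> i y)"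
proof -
  have "(\<Sum>i\<in>V. \<alpha> i * \<phi> i x * \<phi> i y) = (\<Sum>i\<in>V. \<Sum>z\<in>V. A x z * \<phi> i z * \<phi> i y)"
    using eigen assms by (intro sum.cong) (auto simp flip: sum_distrib_right)
  also have "\<dots> = (\<Sum>z\<in>V. \<Sum>i\<in>V. A x z * (\<phi> i z * \<phi> i y))"
    by (subst sum.swap) (simp add: mult.assoc)
  also have "\<dots> = (\<Sum>z\<in>V. of_bool (y = z) * A x z)"
    using complete assms by (intro sum.cong) (auto simp flip: sum_distrib_left)
  also have "\<dots> = A x y" using assms by (rule_tac sum_delta')
  finally show ?thesis by simp
qed

lemma parseval: "(\<Sum>i\<in>V. (\<Sum>x\<in>V. \<phi> i x * g x)\<^sup>2) = (\<Sum>x\<in>V. (g x)\<^sup>2)"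
proof -
  have "(\<Sum>i\<in>V. (\<Sum>x\<in>V. \<phi> i x * g x)\<^sup>2) = (\<Sum>i\<in>V. \<Sum>x\<in>V. \<Sum>y\<in>V. (\<phi> i x * \<phi> i y) * (g x * g y))"
    unfolding power2_eq_square sum_product by (simp add: mult_ac)
  also have "\<dots> = (\<Sum>x\<in>V. \<Sum>y\<in>V. \<Sum>i\<in>V. (\<phi> i x * \<phi> i y) * (g x * g y))"
    by (rule sum_rotate[symmetric])
  also have "\<dots> = (\<Sum>x\<in>V. \<Sum>y\<in>V. of_bool (x = y) * (g x * g y))"
    using complete by (intro sum.cong) (auto simp flip: sum_distrib_right)
  also have "\<dots> = (\<Sum>x\<in>V. (g x)\<^sup>2)"
    by (intro sum.cong) (auto simp: sum_delta' power2_eq_square)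
  finally show ?thesis .
qed

lemma quadratic_form:
  "(\<Sum>x\<in>V. \<Sum>z\<in>V. A x z * h x * h z) = (\<Sum>k\<in>V. \<alpha> k * (\<Sum>x\<in>V. \<phi> k x * h x)\<^sup>2)"
proof -
  have "(\<Sum>x\<in>V. \<Sum>z\<in>V. A x z * h x * h z) = (\<Sum>x\<in>V. \<Sum>z\<in>V. \<Sum>k\<in>V. \<alpha> k * ((\<phi> k x * h x) * (\<phi> k z * h z)))"
    by (intro sum.cong) (auto simp: expand sum_distrib_right sum_distrib_left mult_ac)
  also have "\<dots> = (\<Sum>k\<in>V. \<Sum>x\<in>V. \<Sum>z\<in>V. \<alpha> k * ((\<phi> k x * h x) * (\<phi> k z * h z)))"
    by (rule sum_rotate)
  also have "\<dots> = (\<Sum>k\<in>V. \<alpha> k * (\<Sum>x\<in>V. \<phi> k x * h x)\<^sup>2)"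
    unfolding power2_eq_square sum_product by (simp add: sum_distrib_left)
  finally show ?thesis .
qed

lemma sum_eigenvalues: "(\<Sum>i\<in>V. \<alpha> i) = (\<Sum>x\<in>V. A x x)"
proof -
  have "(\<Sum>x\<in>V. A x x) = (\<Sum>i\<in>V. \<Sum>x\<in>V. \<alpha> i * (\<phi> i x * \<phi> i x))"
    by (subst sum.swap) (auto intro!: sum.cong simp: expand mult.assoc)
  also have "\<dots> = (\<Sum>i\<in>V. \<alpha> i)"
    by (intro sum.cong) (auto simp: orthonormal simp flip: sum_distrib_left)
  finally show ?thesis by simp
qed

lemma eigenvector_entries: "x \<in> V \<Longrightarrow> (\<Sum>i\<in>V. (\<phi> i x)\<^sup>2) = 1"
  using complete[of x x] by (simp add: power2_eq_square)

text \<open>Row \<open>v\<close> of \<open>A\<close> has the coefficients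
  \<open>\<alpha> i * \<phi> i v\<close>, so this is Parseval. For a 0/1 matrix the right side is
  the degree of \<open>v\<close>.\<close>

lemma local_moment2:
  assumes "v \<in> V" shows "(\<Sum>i\<in>V. (\<alpha> i)\<^sup>2 * (\<phi> i v)\<^sup>2) = (\<Sum>y\<in>V. (A v y)\<^sup>2)"
proof -
  have "(\<Sum>i\<in>V. (\<alpha> i)\<^sup>2 * (\<phi> i v)\<^sup>2) = (\<Sum>i\<in>V. (\<Sum>y\<in>V. \<phi> i y * A v y)\<^sup>2)"
    using eigen assms by (intro sum.cong) (auto simp: power_mult_distrib mult.commute)
  then show ?thesis by (simp add: parseval)
qed

text \<open>The quadratic form of \<open>A\<close> at its own row \<open>v\<close>. For an adjacency
  matrix both sides count closed walks of length 3 at \<open>v\<close>.\<close>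

lemma local_moment3:
  assumes "v \<in> V" "\<And>x y. x \<in> V \<Longrightarrow> y \<in> V \<Longrightarrow> A x y = A y x"
  shows "(\<Sum>i\<in>V. (\<alpha> i)^3 * (\<phi> i v)\<^sup>2) = (\<Sum>x\<in>V. \<Sum>y\<in>V. A x y * A v x * A v y)"
proof -
  have "(\<alpha> i)^3 * (\<phi> i v)\<^sup>2 = \<alpha> i * (\<Sum>x\<in>V. \<phi> i x * A v x)\<^sup>2" if "i \<in> V" for i
    using eigen[OF that assms(1)] by (simp add: mult.commute power_mult_distrib power3_eq_cube power2_eq_square)
  then show ?thesis by (simp add: quadratic_form)
qed

lemma eigenvalue_ge:
  assumes "psd_on V (\<lambda>x y. A x y + l * of_bool (x = y))" "i \<in> V"
  shows "- l \<le> \<alpha> i"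
proof -
  have "0 \<le> (\<Sum>x\<in>V. \<Sum>z\<in>V. (A x z + l * of_bool (x = z)) * \<phi> i x * \<phi> i z)"
    using assms(1) unfolding psd_on_def by blast
  also have "\<dots> = (\<Sum>x\<in>V. \<phi> i x * (\<Sum>z\<in>V. A x z * \<phi> i z) + l * \<phi> i x * (\<Sum>z\<in>V. of_bool (x = z) * \<phi> i z))"
    unfolding sum_distrib_left by (simp add: algebra_simps flip: sum.distrib)
  also have "\<dots> = (\<Sum>x\<in>V. (\<alpha> i + l) * (\<phi> i x * \<phi> i x))"
    using assms(2) by (intro sum.cong) (simp_all add: eigen sum_delta', simp add: algebra_simps)
  also have "\<dots> = \<alpha> i + l"
    using orthonormal[of i i] assms(2) by (simp flip: sum_distrib_left)
  finally show ?thesis by simp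
qed

end

text \<open>Expanding \<open>M\<close> in its eigenbasis writes the form of the entrywise product as
  a combination, with coefficients \<open>\<alpha> i \<ge> 0\<close>, of forms of \<open>N\<close>
  at the vectors \<open>\<phi> i x * y x\<close>.\<close>

lemma psd_on_Schur_product:
  assumes "finite V" "\<And>x y. x \<in> V \<Longrightarrow> y \<in> V \<Longrightarrow> M x y = M y x" "psd_on V M" "psd_on V N"
  shows "psd_on V (\<lambda>x y. M x y * N x y)"
proof -
  obtain \<phi> \<alpha> where *:
    "\<And>i j. i \<in> V \<Longrightarrow> j \<in> V \<Longrightarrow> (\<Sum>x\<in>V. \<phi> i x * \<phi> j x) = of_bool (i = j)"
    "\<And>x y. x \<in> V \<Longrightarrow> y \<in> V \<Longrightarrow> (\<Sum>i\<in>V. \<phi> i x * \<phi> i y) = of_bool (x = y)"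
    "\<And>i x. i \<in> V \<Longrightarrow> x \<in> V \<Longrightarrow> (\<Sum>y\<in>V. M x y * \<phi> i y) = \<alpha> i * \<phi> i x"
    using spectral_decomposition[of V M] assms(1,2) by blast
  interpret eigenbasis V M \<phi> \<alpha> by unfold_locales (use assms(1) * in auto)
  have pos: "0 \<le> \<alpha> i" if "i \<in> V" for i using eigenvalue_ge[of 0 i] assms(3) that by simp
  show ?thesis unfolding psd_on_def
  proof
    fix y
    have "(\<Sum>x\<in>V. \<Sum>z\<in>V. M x z * N x z * y x * y z) =
       (\<Sum>x\<in>V. \<Sum>z\<in>V. \<Sum>i\<in>V. \<alpha> i * (N x z * (\<phi> i x * y x) * (\<phi> i z * y z)))"
      by (intro sum.cong) (auto simp: expand sum_distrib_right sum_distrib_left mult_ac)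
    also have "\<dots> = (\<Sum>i\<in>V. \<Sum>x\<in>V. \<Sum>z\<in>V. \<alpha> i * (N x z * (\<phi> i x * y x) * (\<phi> i z * y z)))"
      by (rule sum_rotate)
    also have "\<dots> = (\<Sum>i\<in>V. \<alpha> i * (\<Sum>x\<in>V. \<Sum>z\<in>V. N x z * (\<phi> i x * y x) * (\<phi> i z * y z)))"
      by (simp add: sum_distrib_left)
    also have "\<dots> \<ge> 0"
    proof (rule sum_nonneg)
      fix i assume "i \<in> V"
      have "0 \<le> (\<Sum>x\<in>V. \<Sum>z\<in>V. N x z * (\<phi> i x * y x) * (\<phi> i z * y z))"
        using spec[OF assms(4)[unfolded psd_on_def], of "\<lambda>x. \<phi> i x * y x"] .
      then show "0 \<le> \<alpha> i * (\<Sum>x\<in>V. \<Sum>z\<in>V. N x z * (\<phi> i x * y x) * (\<phi> i z * y z))"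
        using pos[OF \<open>i \<in> V\<close>] by simp
    qed
    finally show "0 \<le> (\<Sum>x\<in>V. \<Sum>z\<in>V. M x z * N x z * y x * y z)" .
  qed
qed

lemma psd_on_Schur_power:
  assumes "finite V" "\<And>x y. x \<in> V \<Longrightarrow> y \<in> V \<Longrightarrow> M x y = M y x" "psd_on V M"
  shows "psd_on V (\<lambda>x y. M x y ^ Suc k)"
proof (induction k)
  case 0 then show ?case using assms(3) by simp
next
  case (Suc k)
  then show ?case using psd_on_Schur_product[OF assms] by simp
qed

section \<open>Hadamard squares of nearly positive semidefinite graphs\<close>

text \<open>\<open>1 < l\<close> gives \<open>l < l\<^sup>2\<close>, hence
  \<open>\<alpha> k + l\<^sup>2 > 0\<close> whenever \<open>\<alpha> k \<ge> - l\<close>; these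
  numbers serve as denominators below.\<close>

locale near_psd_graph = eigenbasis V A \<phi> \<alpha>
  for V :: "'a set" and A :: "'a \<Rightarrow> 'a \<Rightarrow> real" and \<phi> :: "'a \<Rightarrow> 'a \<Rightarrow> real" and \<alpha> :: "'a \<Rightarrow> real" +
  fixes l :: real
  assumes sym: "\<And>x y. x \<in> V \<Longrightarrow> y \<in> V \<Longrightarrow> A x y = A y x"
    and zero_one: "\<And>x y. x \<in> V \<Longrightarrow> y \<in> V \<Longrightarrow> A x y = 0 \<or> A x y = 1"
    and no_loops: "\<And>x. x \<in> V \<Longrightarrow> A x x = 0"
    and psd: "psd_on V (\<lambda>x y. A x y + l * of_bool (x = y))"
    and l_gt_1: "1 < l"
    and nonempty: "V \<noteq> {}"
begin

lemma eigenvalue_lower: "i \<in> V \<Longrightarrow> - l \<le> \<alpha> i"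
  using eigenvalue_ge psd by blast

lemma card_pos: "0 < real (card V)"
  using fin nonempty by (simp add: card_gt_0_iff)

text \<open>Both sides expand the quadratic form of the Hadamard square \<open>A + l\<^sup>2 I\<close> of \<open>A + l I\<close> in the eigenbasis.\<close>

lemma Hadamard_square_form:
  "(\<Sum>i\<in>V. \<Sum>j\<in>V. (\<alpha> i + l) * (\<alpha> j + l) * (\<Sum>x\<in>V. \<phi> i x * \<phi> j x * h x)\<^sup>2) =
     (\<Sum>k\<in>V. (\<alpha> k + l\<^sup>2) * (\<Sum>x\<in>V. \<phi> k x * h x)\<^sup>2)"
proof -
  define b where "b i = \<alpha> i + l" for i
  have expB: "(\<Sum>i\<in>V. b i * (\<phi> i x * \<phi> i z)) = A x z + l * of_bool (x = z)" if "x \<in> V" "z \<in> V" for x z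
  proof -
    have "(\<Sum>i\<in>V. b i * (\<phi> i x * \<phi> i z)) = (\<Sum>i\<in>V. \<alpha> i * \<phi> i x * \<phi> i z) + l * (\<Sum>i\<in>V. \<phi> i x * \<phi> i z)"
      by (simp add: b_def algebra_simps sum.distrib sum_distrib_left)
    then show ?thesis using expand[OF that] complete[OF that] by simp
  qed
  have sq: "(A x z + l * of_bool (x = z))\<^sup>2 = A x z + l\<^sup>2 * of_bool (x = z)" if "x \<in> V" "z \<in> V" for x z
    using zero_one[OF that] no_loops that by (auto simp: power2_eq_square)
  have "(\<Sum>i\<in>V. \<Sum>j\<in>V. b i * b j * (\<Sum>x\<in>V. \<phi> i x * \<phi> j x * h x)\<^sup>2) =
    (\<Sum>i\<in>V. \<Sum>j\<in>V. \<Sum>x\<in>V. \<Sum>z\<in>V. (b i * (\<phi> i x * \<phi> i z)) * (b j * (\<phi> j x * \<phi> j z)) * h x * h z)"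
    by (simp only: power2_eq_square sum_product) (simp add: sum_distrib_left mult_ac)
  also have "\<dots> = (\<Sum>i\<in>V. \<Sum>x\<in>V. \<Sum>z\<in>V. \<Sum>j\<in>V. (b i * (\<phi> i x * \<phi> i z)) * (b j * (\<phi> j x * \<phi> j z)) * h x * h z)"
    by (intro sum.cong refl sum_rotate[symmetric])
  also have "\<dots> = (\<Sum>x\<in>V. \<Sum>z\<in>V. \<Sum>i\<in>V. \<Sum>j\<in>V. (b i * (\<phi> i x * \<phi> i z)) * (b j * (\<phi> j x * \<phi> j z)) * h x * h z)"
    by (rule sum_rotate[symmetric])
  also have "\<dots> = (\<Sum>x\<in>V. \<Sum>z\<in>V. (\<Sum>i\<in>V. b i * (\<phi> i x * \<phi> i z))\<^sup>2 * h x * h z)"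
    by (simp only: power2_eq_square sum_product) (simp add: sum_distrib_right sum_distrib_left mult_ac)
  also have "\<dots> = (\<Sum>x\<in>V. \<Sum>z\<in>V. (A x z + l\<^sup>2 * of_bool (x = z)) * h x * h z)"
    by (intro sum.cong refl) (simp add: expB sq)
  also have "\<dots> = (\<Sum>x\<in>V. \<Sum>z\<in>V. A x z * h x * h z) + (\<Sum>x\<in>V. l\<^sup>2 * h x * (\<Sum>z\<in>V. of_bool (x = z) * h z))"
    unfolding sum_distrib_left sum.distrib[symmetric] by (simp add: algebra_simps)
  also have "(\<Sum>x\<in>V. l\<^sup>2 * h x * (\<Sum>z\<in>V. of_bool (x = z) * h z)) = l\<^sup>2 * (\<Sum>x\<in>V. (h x)\<^sup>2)"
    unfolding sum_distrib_left
    by (intro sum.cong refl) (simp add: sum_delta' sum_distrib_left[symmetric] power2_eq_square)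
  also have "(\<Sum>x\<in>V. (h x)\<^sup>2) = (\<Sum>k\<in>V. (\<Sum>x\<in>V. \<phi> k x * h x)\<^sup>2)"
    by (rule parseval[symmetric])
  finally show ?thesis
    unfolding quadratic_form b_def by (simp add: sum_distrib_left algebra_simps flip: sum.distrib)
qed

text \<open>Fractional form of the bound on the sum of the \<open>R\<close> largest eigenvalues by that of the \<open>R\<^sup>2\<close> largest ones:
  with weights in \<open>[0, 1]\<close> no ordering of the eigenvalues is needed.\<close>

lemma weighted_eigenvalue_square:
  assumes c: "\<And>i. i \<in> V \<Longrightarrow> 0 \<le> c i \<and> c i \<le> 1"
  obtains c' where "\<And>i. i \<in> V \<Longrightarrow> 0 \<le> c' i \<and> c' i \<le> 1" "(\<Sum>i\<in>V. c' i) \<le> (\<Sum>i\<in>V. c i)\<^sup>2"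
    "(\<Sum>i\<in>V. c i * (\<alpha> i + l))\<^sup>2 \<le> real (card V) * ((\<Sum>i\<in>V. c' i * \<alpha> i) + l\<^sup>2 * (\<Sum>i\<in>V. c i)\<^sup>2)"
proof -
  define b where "b i = \<alpha> i + l" for i
  \<comment> \<open>Coefficient along \<open>\<phi> k\<close> of the entrywise product of
    \<open>\<phi> i\<close> and \<open>\<phi> j\<close>.\<close>
  define G where "G i j k = (\<Sum>x\<in>V. \<phi> i x * \<phi> j x * \<phi> k x)" for i j k
  define m where "m k = \<alpha> k + l\<^sup>2" for k
  \<comment> \<open>\<open>a k\<close> is the value at \<open>\<phi> k\<close> of the Hadamard
    square of the matrix with eigenvalues \<open>c i * b i\<close>. The new weights will be
    \<open>a k / m k\<close>.\<close>
  define a where "a k = (\<Sum>i\<in>V. \<Sum>j\<in>V. (c i * c j) * (b i * b j * (G i j k)\<^sup>2))" for k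
  have b0: "0 \<le> b i" if "i \<in> V" for i using eigenvalue_lower[OF that] by (simp add: b_def)
  have m0: "0 < m k" if "k \<in> V" for k
  proof -
    have "l * 1 < l * l" using l_gt_1 by (intro mult_strict_left_mono) auto
    then show ?thesis using eigenvalue_lower[OF that] by (simp add: m_def power2_eq_square)
  qed
  have cij: "0 \<le> c i * c j" "c i * c j \<le> 1" if "i \<in> V" "j \<in> V" for i j
    using c[OF that(1)] c[OF that(2)] by (auto simp: mult_le_one)
  have a0: "0 \<le> a k" for k unfolding a_def
    by (intro sum_nonneg mult_nonneg_nonneg cij b0) auto
  \<comment> \<open>Raising all weights to 1 gives the full Hadamard square, whose value at
    \<open>\<phi> k\<close> is \<open>m k\<close>; so the new weights are at most 1.\<close>
  have am: "a k \<le> m k" if k: "k \<in> V" for k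
  proof -
    have "a k \<le> (\<Sum>i\<in>V. \<Sum>j\<in>V. 1 * (b i * b j * (G i j k)\<^sup>2))"
      unfolding a_def by (intro sum_mono mult_right_mono cij mult_nonneg_nonneg b0) auto
    also have "\<dots> = (\<Sum>p\<in>V. m p * (\<Sum>x\<in>V. \<phi> p x * \<phi> k x)\<^sup>2)"
      using Hadamard_square_form[of "\<phi> k"] by (simp add: b_def G_def m_def)
    also have "\<dots> = (\<Sum>p\<in>V. of_bool (k = p) * m p)"
      using k by (intro sum.cong refl) (auto simp: orthonormal)
    also have "\<dots> = m k" using k by (rule sum_delta')
    finally show ?thesis .
  qed
  \<comment> \<open>Test the Hadamard identity on \<open>h\<close>, the image of the product of
    \<open>\<phi> i\<close> and \<open>\<phi> j\<close> under the inverse of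
    \<open>A + l\<^sup>2 I\<close>: the right side is \<open>Z\<close>, and on the left the
    \<open>(i, j)\<close> term alone is \<open>b i * b j * Z\<^sup>2\<close>.\<close>
  have Z: "b i * b j * (\<Sum>k\<in>V. (G i j k)\<^sup>2 / m k) \<le> 1" if ij: "i \<in> V" "j \<in> V" for i j
  proof -
    define Z where "Z = (\<Sum>k\<in>V. (G i j k)\<^sup>2 / m k)"
    define h where "h x = (\<Sum>k\<in>V. G i j k / m k * \<phi> k x)" for x
    have "(\<Sum>x\<in>V. \<phi> i x * \<phi> j x * h x) = (\<Sum>k\<in>V. \<Sum>x\<in>V. \<phi> i x * \<phi> j x * (G i j k / m k * \<phi> k x))"
      unfolding h_def sum_distrib_left by (rule sum.swap)
    also have "\<dots> = (\<Sum>k\<in>V. G i j k / m k * G i j k)"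
      unfolding G_def[of i j] sum_distrib_left by (intro sum.cong refl) (simp add: mult_ac)
    finally have hZ: "(\<Sum>x\<in>V. \<phi> i x * \<phi> j x * h x) = Z" by (simp add: Z_def power2_eq_square)
    have hk: "(\<Sum>x\<in>V. \<phi> p x * h x) = G i j p / m p" if "p \<in> V" for p
    proof -
      have "(\<Sum>x\<in>V. \<phi> p x * h x) = (\<Sum>k\<in>V. \<Sum>x\<in>V. \<phi> p x * (G i j k / m k * \<phi> k x))"
        unfolding h_def sum_distrib_left by (rule sum.swap)
      also have "\<dots> = (\<Sum>k\<in>V. (\<Sum>x\<in>V. \<phi> p x * \<phi> k x) * (G i j k / m k))"
        unfolding sum_distrib_right by (simp add: mult_ac)
      also have "\<dots> = (\<Sum>k\<in>V. of_bool (p = k) * (G i j k / m k))"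
        using that by (intro sum.cong refl) (simp add: orthonormal)
      finally show ?thesis by (simp only: sum_delta'[OF that])
    qed
    have "b i * b j * Z\<^sup>2 \<le> (\<Sum>j\<in>V. b i * b j * (\<Sum>x\<in>V. \<phi> i x * \<phi> j x * h x)\<^sup>2)"
      unfolding hZ[symmetric]
      using member_le_sum[of j V "\<lambda>j. b i * b j * (\<Sum>x\<in>V. \<phi> i x * \<phi> j x * h x)\<^sup>2"] ij fin b0 by simp
    also have "\<dots> \<le> (\<Sum>i\<in>V. \<Sum>j\<in>V. b i * b j * (\<Sum>x\<in>V. \<phi> i x * \<phi> j x * h x)\<^sup>2)"
      using ij fin b0 by (intro member_le_sum sum_nonneg mult_nonneg_nonneg) auto
    also have "\<dots> = (\<Sum>k\<in>V. m k * (\<Sum>x\<in>V. \<phi> k x * h x)\<^sup>2)"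
      using Hadamard_square_form[of h] by (simp add: b_def m_def)
    also have "\<dots> = Z"
      unfolding Z_def
    proof (intro sum.cong refl)
      fix k assume "k \<in> V"
      then show "m k * (\<Sum>x\<in>V. \<phi> k x * h x)\<^sup>2 = (G i j k)\<^sup>2 / m k"
        using m0[of k] by (simp add: hk power2_eq_square)
    qed
    finally have le: "(b i * b j * Z) * Z \<le> 1 * Z" by (simp add: power2_eq_square mult_ac)
    have "0 \<le> Z" unfolding Z_def using m0 by (intro sum_nonneg) (simp add: less_imp_le)
    then have "b i * b j * Z \<le> 1"
      using le by (cases "Z = 0") (auto simp: mult_le_cancel_right)
    then show ?thesis by (simp add: Z_def)
  qed
  have sum_am: "(\<Sum>k\<in>V. a k / m k) \<le> (\<Sum>i\<in>V. c i)\<^sup>2"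
  proof -
    have "(\<Sum>k\<in>V. a k / m k) = (\<Sum>k\<in>V. \<Sum>i\<in>V. \<Sum>j\<in>V. (c i * c j) * (b i * b j * ((G i j k)\<^sup>2 / m k)))"
      by (simp add: a_def sum_divide_distrib)
    also have "\<dots> = (\<Sum>i\<in>V. \<Sum>j\<in>V. (c i * c j) * (b i * b j * (\<Sum>k\<in>V. (G i j k)\<^sup>2 / m k)))"
      by (subst sum_rotate[symmetric]) (simp add: sum_distrib_left)
    also have "\<dots> \<le> (\<Sum>i\<in>V. \<Sum>j\<in>V. (c i * c j) * 1)"
      by (intro sum_mono mult_left_mono Z cij)
    also have "\<dots> = (\<Sum>i\<in>V. c i)\<^sup>2" by (simp add: power2_eq_square sum_product)
    finally show ?thesis .
  qed
  \<comment> \<open>By Parseval the \<open>a k\<close> add up to the sum of the squared diagonal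
    entries of the weighted matrix.\<close>
  have sum_a: "(\<Sum>k\<in>V. a k) = (\<Sum>x\<in>V. (\<Sum>i\<in>V. c i * b i * (\<phi> i x)\<^sup>2)\<^sup>2)"
  proof -
    have "(\<Sum>k\<in>V. a k) = (\<Sum>i\<in>V. \<Sum>j\<in>V. (c i * c j) * (b i * b j * (\<Sum>k\<in>V. (G i j k)\<^sup>2)))"
      unfolding a_def by (subst sum_rotate[symmetric]) (simp add: sum_distrib_left)
    also have "\<dots> = (\<Sum>i\<in>V. \<Sum>j\<in>V. \<Sum>x\<in>V. (c i * c j) * (b i * b j * (\<phi> i x * \<phi> j x)\<^sup>2))"
    proof (intro sum.cong refl)
      fix i j
      have "(\<Sum>k\<in>V. (G i j k)\<^sup>2) = (\<Sum>x\<in>V. (\<phi> i x * \<phi> j x)\<^sup>2)"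
        using parseval[of "\<lambda>x. \<phi> i x * \<phi> j x"] by (simp add: G_def mult_ac)
      then show "(c i * c j) * (b i * b j * (\<Sum>k\<in>V. (G i j k)\<^sup>2)) = (\<Sum>x\<in>V. (c i * c j) * (b i * b j * (\<phi> i x * \<phi> j x)\<^sup>2))"
        by (simp add: sum_distrib_left)
    qed
    also have "\<dots> = (\<Sum>x\<in>V. \<Sum>i\<in>V. \<Sum>j\<in>V. (c i * c j) * (b i * b j * (\<phi> i x * \<phi> j x)\<^sup>2))"
      by (rule sum_rotate)
    also have "\<dots> = (\<Sum>x\<in>V. (\<Sum>i\<in>V. c i * b i * (\<phi> i x)\<^sup>2)\<^sup>2)"
      unfolding power2_eq_square sum_product by (simp add: mult_ac)
    finally show ?thesis .
  qed
  \<comment> \<open>The weighted sum is the trace of that matrix; Cauchy-Schwarz along the diagonal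
    compares it with \<open>sum_a\<close>.\<close>
  have "(\<Sum>i\<in>V. c i * b i) = (\<Sum>i\<in>V. c i * b i * (\<Sum>x\<in>V. (\<phi> i x)\<^sup>2))"
    using orthonormal by (intro sum.cong refl) (simp add: power2_eq_square)
  also have "\<dots> = (\<Sum>x\<in>V. 1 * (\<Sum>i\<in>V. c i * b i * (\<phi> i x)\<^sup>2))"
    unfolding sum_distrib_left by (subst sum.swap) simp
  finally have "(\<Sum>i\<in>V. c i * b i)\<^sup>2 = (\<Sum>x\<in>V. 1 * (\<Sum>i\<in>V. c i * b i * (\<phi> i x)\<^sup>2))\<^sup>2" by simp
  also have "\<dots> \<le> (\<Sum>x\<in>V. 1\<^sup>2) * (\<Sum>x\<in>V. (\<Sum>i\<in>V. c i * b i * (\<phi> i x)\<^sup>2)\<^sup>2)"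
    by (rule Cauchy_Schwarz_ineq_sum)
  also have "\<dots> = real (card V) * (\<Sum>k\<in>V. a k / m k * m k)"
  proof -
    have "(\<Sum>k\<in>V. a k / m k * m k) = (\<Sum>k\<in>V. a k)"
      using m0 by (intro sum.cong refl) (metis less_irrefl nonzero_eq_divide_eq)
    then show ?thesis by (simp add: sum_a)
  qed
  also have "(\<Sum>k\<in>V. a k / m k * m k) = (\<Sum>k\<in>V. a k / m k * \<alpha> k) + l\<^sup>2 * (\<Sum>k\<in>V. a k / m k)"
    unfolding m_def by (simp add: add_divide_distrib distrib_left sum.distrib sum_distrib_left mult_ac)
  also have "real (card V) * \<dots> \<le> real (card V) * ((\<Sum>k\<in>V. a k / m k * \<alpha> k) + l\<^sup>2 * (\<Sum>i\<in>V. c i)\<^sup>2)"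
    by (intro mult_left_mono add_left_mono sum_am) auto
  finally have main: "(\<Sum>i\<in>V. c i * b i)\<^sup>2 \<le> real (card V) * ((\<Sum>k\<in>V. a k / m k * \<alpha> k) + l\<^sup>2 * (\<Sum>i\<in>V. c i)\<^sup>2)" .
  have "0 \<le> a k / m k \<and> a k / m k \<le> 1" if "k \<in> V" for k
    using a0[of k] am[OF that] m0[OF that] by simp
  then show ?thesis using that[of "\<lambda>k. a k / m k"] sum_am main by (simp add: b_def)
qed

end

section \<open>Growth of eigenvalue sums\<close>

text \<open>Strip off the smallest value repeatedly: among \<open>n + 1\<close> values with sum at
  most \<open>2 (n + 1)^(1/4)\<close> its square is at most \<open>4 / (n + 1)^(3/2)\<close>, and
  these bounds for \<open>n \<ge> r\<close> add up to at most \<open>8 / sqrt r\<close>.\<close>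

lemma small_square_sum_outside_top:
  fixes x :: "'a \<Rightarrow> real"
  assumes "finite P" "\<And>i. i \<in> P \<Longrightarrow> 0 < x i"
    and "\<And>J. J \<subseteq> P \<Longrightarrow> J \<noteq> {} \<Longrightarrow> (\<Sum>i\<in>J. x i) \<le> 2 * real (card J) powr (1/4)"
    and "1 \<le> r"
  obtains I where "I \<subseteq> P" "card I \<le> r" "(\<Sum>i\<in>P - I. (x i)\<^sup>2) \<le> 8 / sqrt r"
proof -
  have key: "\<exists>I\<subseteq>P. card I \<le> r \<and> (\<Sum>i\<in>P - I. (x i)\<^sup>2) \<le> 8 / sqrt r - 8 / sqrt (r + k)"
    if "card P = r + k" "finite P" "\<And>i. i \<in> P \<Longrightarrow> 0 < x i"
      "\<And>J. J \<subseteq> P \<Longrightarrow> J \<noteq> {} \<Longrightarrow> (\<Sum>i\<in>J. x i) \<le> 2 * real (card J) powr (1/4)" for P k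
    using that
  proof (induction k arbitrary: P)
    case 0
    then show ?case by (intro exI[of _ P]) auto
  next
    case (Suc k)
    define n where "n = r + k"
    have n1: "1 \<le> n" using assms(4) by (simp add: n_def)
    have cP: "card P = Suc n" using Suc.prems(1) by (simp add: n_def)
    then have "P \<noteq> {}" by auto
    define y where "y = arg_min_on x P"
    have y: "y \<in> P" "\<And>i. i \<in> P \<Longrightarrow> x y \<le> x i"
      using arg_min_if_finite[OF Suc.prems(2) \<open>P \<noteq> {}\<close>, of x] by (force simp: y_def)+
    have "\<exists>I\<subseteq>P - {y}. card I \<le> r \<and> (\<Sum>i\<in>P - {y} - I. (x i)\<^sup>2) \<le> 8 / sqrt r - 8 / sqrt (r + k)"
      using y(1) Suc.prems cP by (intro Suc.IH) (auto simp: n_def)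
    then obtain I where I: "I \<subseteq> P - {y}" "card I \<le> r"
      and Is: "(\<Sum>i\<in>P - {y} - I. (x i)\<^sup>2) \<le> 8 / sqrt r - 8 / sqrt n" by (auto simp: n_def)
    define a b where "a = sqrt (real n)" and "b = sqrt (real (Suc n))"
    have ab: "0 < a" "a \<le> b" "b\<^sup>2 = real (Suc n)" "a\<^sup>2 = real n" using n1 by (auto simp: a_def b_def)
    have b0: "0 < b" using ab by linarith
    have "real (Suc n) * x y = (\<Sum>i\<in>P. x y)" using cP by simp
    also have "\<dots> \<le> (\<Sum>i\<in>P. x i)" by (intro sum_mono y)
    also have "\<dots> \<le> 2 * real (Suc n) powr (1/4)" using Suc.prems(4)[of P] \<open>P \<noteq> {}\<close> cP by simp
    finally have "(real (Suc n) * x y)\<^sup>2 \<le> (2 * real (Suc n) powr (1/4))\<^sup>2"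
      using Suc.prems(3)[OF y(1)] by (intro power_mono) auto
    also have "\<dots> = 4 * (real (Suc n) powr (1/4) * real (Suc n) powr (1/4))"
      by (simp add: power2_eq_square)
    also have "\<dots> = 4 * b" unfolding powr_add[symmetric] b_def by (simp add: powr_half_sqrt)
    finally have "b^4 * (x y)\<^sup>2 \<le> 4 * b"
      unfolding ab(3)[symmetric] by (simp add: power_mult_distrib flip: power_mult)
    moreover have "b^4 = b * b^3" by (simp add: power_numeral_reduce)
    ultimately have "b * (b^3 * (x y)\<^sup>2) \<le> b * 4" by (simp add: mult.assoc mult.commute[of b 4])
    then have "b^3 * (x y)\<^sup>2 \<le> 4" using b0 by (rule mult_left_le_imp_le)
    then have "(x y)\<^sup>2 \<le> 4 / b^3" using b0 by (simp add: field_simps)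
    \<comment> \<open>Telescoping: the difference is \<open>8 / (a * b * (b + a))\<close>, and
      \<open>a \<le> b\<close>.\<close>
    also have "\<dots> \<le> 8 / a - 8 / b"
    proof -
      have "(b - a) * (b + a) = 1" using ab by (simp add: algebra_simps power2_eq_square)
      then have "b - a = 1 / (b + a)" using ab b0 by (simp add: field_simps)
      moreover have "8 / a - 8 / b = 8 * (b - a) / (a * b)" using ab b0 by (simp add: field_simps)
      ultimately have "8 / a - 8 / b = 8 / (a * b * (b + a))" by (simp add: mult_ac)
      moreover have "a * b * (b + a) \<le> b * b * (b + b)"
        using ab b0 by (intro mult_mono) auto
      then have "8 / (b * b * (b + b)) \<le> 8 / (a * b * (b + a))"
        using ab b0 by (intro divide_left_mono) auto
      ultimately show ?thesis using b0 by (simp add: power3_eq_cube)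
    qed
    finally have xy: "(x y)\<^sup>2 \<le> 8 / a - 8 / b" .
    have "P - I = insert y (P - {y} - I)" using y(1) I by auto
    then have "(\<Sum>i\<in>P - I. (x i)\<^sup>2) = (x y)\<^sup>2 + (\<Sum>i\<in>P - {y} - I. (x i)\<^sup>2)"
      using Suc.prems(2) by (simp add: sum.insert_remove)
    also have "\<dots> \<le> 8 / sqrt r - 8 / sqrt (r + Suc k)"
      using xy Is by (simp add: a_def b_def n_def)
    finally show ?case using I by blast
  qed
  show ?thesis
  proof (cases "card P \<le> r")
    case True
    then show ?thesis using that[of P] by simp
  next
    case False
    then obtain k where k: "card P = r + k" by (metis le_Suc_ex nat_le_linear)
    obtain I where "I \<subseteq> P" "card I \<le> r" "(\<Sum>i\<in>P - I. (x i)\<^sup>2) \<le> 8 / sqrt r - 8 / sqrt (r + k)"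
      using key[OF k assms(1,2,3)] by blast
    moreover have "0 \<le> 8 / sqrt (real (r + k))" by simp
    ultimately show ?thesis by (intro that[of I]) linarith+
  qed
qed

context near_psd_graph
begin

text \<open>The linear programming form of the bound \<open>\<sigma>(R) \<le> t\<close>. Weights in
  \<open>[0, 1]\<close> allow real \<open>R\<close>, and weight 0 drops negative eigenvalues, which
  makes the bound monotone in \<open>R\<close>.\<close>

definition top_sum_le :: "real \<Rightarrow> real \<Rightarrow> bool" where
  "top_sum_le R t \<longleftrightarrow> (\<forall>c. (\<forall>i\<in>V. 0 \<le> c i \<and> c i \<le> 1) \<and> (\<Sum>i\<in>V. c i) \<le> R \<longrightarrow>
     (\<Sum>i\<in>V. c i * \<alpha> i) \<le> t * real (card V))"

lemma top_sum_le_mono: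
  assumes "top_sum_le R t" "R' \<le> R" "t \<le> t'" shows "top_sum_le R' t'"
proof -
  have "t * real (card V) \<le> t' * real (card V)" using assms(3) by (intro mult_right_mono) auto
  then show ?thesis using assms(1,2) unfolding top_sum_le_def by (meson order_trans)
qed

text \<open>The trace of \<open>A\<close> is 0, so the nonnegative numbers
  \<open>\<alpha> i + l\<close> add up to \<open>l * real (card V)\<close>, and each dominates
  \<open>c i * \<alpha> i\<close>.\<close>

lemma top_sum_le_trivial: "top_sum_le R l"
  unfolding top_sum_le_def
proof safe
  fix c :: "'a \<Rightarrow> real" assume c: "\<forall>i\<in>V. 0 \<le> c i \<and> c i \<le> 1"
  have "(\<Sum>i\<in>V. c i * \<alpha> i) \<le> (\<Sum>i\<in>V. \<alpha> i + l)"
  proof (rule sum_mono)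
    fix i assume i: "i \<in> V"
    show "c i * \<alpha> i \<le> \<alpha> i + l"
    proof (cases "0 \<le> \<alpha> i")
      case True
      then have "c i * \<alpha> i \<le> 1 * \<alpha> i" using c i by (intro mult_right_mono) auto
      then show ?thesis using l_gt_1 by simp
    next
      case False
      then have "c i * \<alpha> i \<le> 0" using c i by (simp add: mult_nonneg_nonpos)
      then show ?thesis using eigenvalue_lower[OF i] by simp
    qed
  qed
  also have "\<dots> = l * real (card V)" using sum_eigenvalues no_loops by (simp add: sum.distrib)
  finally show "(\<Sum>i\<in>V. c i * \<alpha> i) \<le> l * real (card V)" .
qed

text \<open>\<open>weighted_eigenvalue_square\<close> trades weights of total at most
  \<open>R\<close> for weights of total at most \<open>R\<^sup>2\<close>, to which the hypothesis
  applies.\<close>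

lemma top_sum_le_sqrt:
  assumes "top_sum_le (R\<^sup>2) t" "0 \<le> R" "0 \<le> t"
  shows "top_sum_le R (sqrt (t + l\<^sup>2 * R\<^sup>2 / real (card V)))"
  unfolding top_sum_le_def
proof safe
  define s where "s = real (card V)"
  have s: "0 < s" using card_pos by (simp add: s_def)
  fix c :: "'a \<Rightarrow> real" assume c: "\<forall>i\<in>V. 0 \<le> c i \<and> c i \<le> 1" and cR: "(\<Sum>i\<in>V. c i) \<le> R"
  have c0: "0 \<le> (\<Sum>i\<in>V. c i)" using c by (intro sum_nonneg) auto
  obtain c' where c': "\<And>i. i \<in> V \<Longrightarrow> 0 \<le> c' i \<and> c' i \<le> 1" "(\<Sum>i\<in>V. c' i) \<le> (\<Sum>i\<in>V. c i)\<^sup>2"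
    and le: "(\<Sum>i\<in>V. c i * (\<alpha> i + l))\<^sup>2 \<le> s * ((\<Sum>i\<in>V. c' i * \<alpha> i) + l\<^sup>2 * (\<Sum>i\<in>V. c i)\<^sup>2)"
    using weighted_eigenvalue_square[of c] c unfolding s_def by blast
  have R2: "(\<Sum>i\<in>V. c i)\<^sup>2 \<le> R\<^sup>2" using cR c0 by (rule power_mono)
  have "(\<Sum>i\<in>V. c' i * \<alpha> i) \<le> t * s"
    using assms(1) c' R2 unfolding top_sum_le_def s_def by force
  then have "(\<Sum>i\<in>V. c' i * \<alpha> i) + l\<^sup>2 * (\<Sum>i\<in>V. c i)\<^sup>2 \<le> t * s + l\<^sup>2 * R\<^sup>2"
    using R2 by (intro add_mono mult_left_mono) auto
  then have "s * ((\<Sum>i\<in>V. c' i * \<alpha> i) + l\<^sup>2 * (\<Sum>i\<in>V. c i)\<^sup>2) \<le> s * (t * s + l\<^sup>2 * R\<^sup>2)"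
    using s by (intro mult_left_mono) auto
  also have "\<dots> = (t + l\<^sup>2 * R\<^sup>2 / s) * s\<^sup>2" using s by (simp add: field_simps power2_eq_square)
  finally have "(\<Sum>i\<in>V. c i * (\<alpha> i + l))\<^sup>2 \<le> (t + l\<^sup>2 * R\<^sup>2 / s) * s\<^sup>2" using le by linarith
  then have "(\<Sum>i\<in>V. c i * (\<alpha> i + l)) \<le> sqrt ((t + l\<^sup>2 * R\<^sup>2 / s) * s\<^sup>2)" by (rule real_le_rsqrt)
  also have "\<dots> = sqrt (t + l\<^sup>2 * R\<^sup>2 / s) * s" using s by (simp add: real_sqrt_mult)
  finally have "(\<Sum>i\<in>V. c i * (\<alpha> i + l)) \<le> sqrt (t + l\<^sup>2 * R\<^sup>2 / s) * s" .
  moreover have "(\<Sum>i\<in>V. c i * \<alpha> i) \<le> (\<Sum>i\<in>V. c i * (\<alpha> i + l))"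
    using c l_gt_1 by (intro sum_mono mult_left_mono) auto
  ultimately show "(\<Sum>i\<in>V. c i * \<alpha> i) \<le> sqrt (t + l\<^sup>2 * R\<^sup>2 / real (card V)) * real (card V)"
    unfolding s_def by linarith
qed

text \<open>Squaring \<open>R\<close> \<open>k\<close> times within the limit \<open>Y\<close> and
  taking \<open>k\<close> roots turns the trivial bound \<open>l\<close> into
  \<open>l powr (1 / 2 ^ k)\<close>. The error factor reproduces itself because
  \<open>1 + 2 * e \<le> (1 + e)\<^sup>2\<close>.\<close>

lemma top_sum_le_iterate:
  assumes e: "e = l\<^sup>2 * Y / real (card V)"
  shows "1 \<le> R \<Longrightarrow> R ^ (2 ^ k) \<le> Y \<Longrightarrow> top_sum_le R ((1 + e) * l powr (1 / 2 ^ k))"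
proof (induction k arbitrary: R)
  case 0
  have "0 \<le> e" using 0 by (simp add: e)
  then have "l \<le> (1 + e) * l" using l_gt_1 by (simp add: distrib_right)
  then show ?case using top_sum_le_mono[OF top_sum_le_trivial, of R R] l_gt_1 by simp
next
  case (Suc k)
  define L where "L = l powr (1 / 2 ^ k)"
  have L1: "1 \<le> L" unfolding L_def using l_gt_1 by (intro ge_one_powr_ge_zero) auto
  have R2: "(R\<^sup>2) ^ (2 ^ k) \<le> Y" using Suc.prems(2) by (simp add: power_mult)
  have R1: "1 \<le> R\<^sup>2" using Suc.prems(1) by (simp add: one_le_power)
  have "(R\<^sup>2) ^ 1 \<le> (R\<^sup>2) ^ (2 ^ k)" by (intro power_increasing R1) auto
  then have RY: "R\<^sup>2 \<le> Y" using R2 by simp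
  have e0: "0 \<le> e" using RY R1 by (auto simp: e)
  have "top_sum_le (R\<^sup>2) ((1 + e) * L)" unfolding L_def using Suc.IH[OF R1 R2] .
  then have *: "top_sum_le R (sqrt ((1 + e) * L + l\<^sup>2 * R\<^sup>2 / real (card V)))"
    using Suc.prems(1) L1 e0 by (intro top_sum_le_sqrt) auto
  have "l\<^sup>2 * R\<^sup>2 / real (card V) \<le> e" unfolding e using RY by (intro divide_right_mono mult_left_mono) auto
  moreover have "e \<le> e * L" using L1 e0 by (simp add: mult_le_cancel_left1)
  ultimately have "(1 + e) * L + l\<^sup>2 * R\<^sup>2 / real (card V) \<le> (1 + 2 * e) * L" by (simp add: algebra_simps)
  also have "\<dots> \<le> (1 + e)\<^sup>2 * L" using L1 by (intro mult_right_mono) (auto simp: power2_eq_square algebra_simps)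
  finally have "sqrt ((1 + e) * L + l\<^sup>2 * R\<^sup>2 / real (card V)) \<le> sqrt ((1 + e)\<^sup>2 * L)" by simp
  also have "\<dots> = (1 + e) * sqrt L" using e0 by (simp add: real_sqrt_mult)
  also have "sqrt L = l powr (1 / 2 ^ Suc k)"
    using l_gt_1 by (simp add: L_def powr_powr mult.commute flip: powr_half_sqrt)
  finally show ?case using top_sum_le_mono[OF *] by blast
qed

text \<open>Iterate as long as \<open>Y\<close> allows: for the last admissible \<open>k\<close> one
  has \<open>Y < S ^ (2 ^ Suc k)\<close>, and then \<open>l \<le> Y powr (\<eta> / 2)\<close> makes
  \<open>l powr (1 / 2 ^ k)\<close> at most \<open>S powr \<eta>\<close>.\<close>

lemma top_sum_le_growth:
  assumes e: "e = l\<^sup>2 * Y / real (card V)" and Y: "1 \<le> Y" and l: "l \<le> Y powr (\<eta> / 2)" and \<eta>: "0 \<le> \<eta>"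
    and R: "1 \<le> R"
  shows "top_sum_le R ((1 + e) * (2 * R) powr \<eta>)"
proof -
  \<comment> \<open>The factor 2 keeps the base at least 2, so that its powers exceed
    \<open>Y\<close> also for \<open>R = 1\<close>.\<close>
  define S where "S = 2 * R"
  have S: "2 \<le> S" using R by (simp add: S_def)
  have e0: "0 \<le> e" using Y by (simp add: e)
  have "top_sum_le S ((1 + e) * S powr \<eta>)"
  proof (cases "S \<le> Y")
    case True
    obtain n where "Y < S ^ n" using real_arch_pow[of S Y] S by auto
    also have "S ^ n \<le> S ^ (2 ^ n)" using S by (intro power_increasing) auto
    finally have "\<not> S ^ (2 ^ n) \<le> Y" by simp
    moreover have "S ^ (2 ^ 0) \<le> Y" using True by simp
    ultimately have "\<exists>k. S ^ (2 ^ k) \<le> Y \<and> \<not> S ^ (2 ^ Suc k) \<le> Y"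
      using nat_induct[of "\<lambda>k. S ^ (2 ^ k) \<le> Y" n] by blast
    then obtain k where k: "S ^ (2 ^ k) \<le> Y" "Y < S ^ (2 ^ Suc k)" by (auto simp: not_le)
    have "l powr (1 / 2 ^ k) \<le> (Y powr (\<eta> / 2)) powr (1 / 2 ^ k)"
      using l l_gt_1 by (intro powr_mono2) auto
    also have "\<dots> \<le> ((S ^ (2 ^ Suc k)) powr (\<eta> / 2)) powr (1 / 2 ^ k)"
      using k(2) Y \<eta> by (intro powr_mono2) auto
    also have "S ^ (2 ^ Suc k) = S powr real (2 ^ Suc k)"
      using S by (intro powr_realpow[symmetric]) auto
    also have "((S powr real (2 ^ Suc k)) powr (\<eta> / 2)) powr (1 / 2 ^ k) = S powr (real (2 ^ Suc k) * (\<eta> / 2) * (1 / 2 ^ k))"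
      unfolding powr_powr ..
    also have "real (2 ^ Suc k) * (\<eta> / 2) * (1 / 2 ^ k) = \<eta>" by simp
    finally have "(1 + e) * l powr (1 / 2 ^ k) \<le> (1 + e) * S powr \<eta>" using e0 by (intro mult_left_mono) auto
    then show ?thesis using top_sum_le_mono[OF top_sum_le_iterate[OF e _ k(1)]] S by simp
  next
    case False
    have "l \<le> Y powr (\<eta> / 2)" by (rule l)
    also have "\<dots> \<le> S powr (\<eta> / 2)" using False Y \<eta> by (intro powr_mono2) auto
    also have "\<dots> \<le> S powr \<eta>" using S \<eta> by (intro powr_mono) auto
    also have "\<dots> \<le> (1 + e) * S powr \<eta>" using e0 by (simp add: distrib_right)
    finally show ?thesis using top_sum_le_mono[OF top_sum_le_trivial] by blast
  qed
  then show ?thesis using R unfolding S_def by (rule_tac top_sum_le_mono) auto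
qed

lemma top_sum_le_subset:
  assumes "top_sum_le R t" "J \<subseteq> V" "real (card J) \<le> R"
  shows "(\<Sum>i\<in>J. \<alpha> i) \<le> t * real (card V)"
proof -
  have "(\<Sum>i\<in>V. of_bool (i \<in> J) * \<alpha> i) = (\<Sum>i\<in>J. \<alpha> i)"
    using assms(2) fin by (intro sum.mono_neutral_cong_right) auto
  moreover have "(\<Sum>i\<in>V. of_bool (i \<in> J)) = real (card J)"
    using assms(2) fin by (simp add: Int_absorb1)
  ultimately show ?thesis
    using assms(1,3) unfolding top_sum_le_def by (auto dest!: spec[of _ "\<lambda>i. of_bool (i \<in> J)"])
qed

text \<open>An eigenvalue that is not positive has square at most \<open>l\<^sup>2\<close>. Sums of
  positive ones, divided by \<open>s\<close>, grow slowly enough for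
  \<open>small_square_sum_outside_top\<close>.\<close>

lemma few_dominant_eigenvalues:
  assumes e: "e = l\<^sup>2 * Y / real (card V)" "e \<le> 1/2" and Y: "1 \<le> Y" and l: "l \<le> Y powr (\<eta> / 2)"
    and \<eta>: "0 \<le> \<eta>" "\<eta> \<le> 1/4" and r: "1 \<le> r"
  obtains I where "I \<subseteq> V" "\<And>i. i \<in> I \<Longrightarrow> 0 < \<alpha> i" "card I \<le> r"
    "(\<Sum>i\<in>V - I. (\<alpha> i)\<^sup>2) \<le> l\<^sup>2 * real (card V) + 8 * (real (card V))\<^sup>2 / sqrt r"
proof -
  define s where "s = real (card V)"
  have s: "0 < s" using card_pos by (simp add: s_def)
  define P where "P = {i \<in> V. 0 < \<alpha> i}"
  have P: "P \<subseteq> V" "finite P" using fin by (auto simp: P_def)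
  have "(\<Sum>i\<in>J. \<alpha> i / s) \<le> 2 * real (card J) powr (1/4)" if J: "J \<subseteq> P" "J \<noteq> {}" for J
  proof -
    define n where "n = real (card J)"
    have "finite J" using P J by (meson finite_subset)
    then have n: "1 \<le> n" using J by (simp add: n_def Suc_leI card_gt_0_iff)
    have "(\<Sum>i\<in>J. \<alpha> i) \<le> ((1 + e) * (2 * n) powr \<eta>) * s"
      using top_sum_le_subset[OF top_sum_le_growth[OF e(1) Y l \<eta>(1) n]] J P by (simp add: n_def s_def)
    \<comment> \<open>\<open>e \<le> 1/2\<close> and \<open>2 \<le> (4/3)^4\<close> give the
      constant \<open>3/2 * 4/3 = 2\<close>.\<close>
    also have "\<dots> \<le> ((3/2) * (4/3 * n powr (1/4))) * s"
    proof (intro mult_right_mono mult_mono)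
      have "(2 * n) powr \<eta> \<le> (2 * n) powr (1/4)" using n \<eta> by (intro powr_mono) auto
      also have "\<dots> = 2 powr (1/4) * n powr (1/4)" using n by (simp add: powr_mult)
      also have "\<dots> \<le> ((4/3)^4) powr (1/4) * n powr (1/4)"
        by (intro mult_right_mono powr_mono2) (auto simp: power4_eq_xxxx)
      also have "((4/3)^4) powr (1/4) = ((4/3 :: real) powr 4) powr (1/4)" by simp
      also have "\<dots> = 4/3" unfolding powr_powr by simp
      finally show "(2 * n) powr \<eta> \<le> 4/3 * n powr (1/4)" .
    qed (use e s in auto)
    finally have "(\<Sum>i\<in>J. \<alpha> i) \<le> 2 * n powr (1/4) * s" by simp
    then show ?thesis using s unfolding n_def sum_divide_distrib[symmetric] by (simp add: pos_divide_le_eq)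
  qed
  then obtain I where I: "I \<subseteq> P" "card I \<le> r" and le: "(\<Sum>i\<in>P - I. (\<alpha> i / s)\<^sup>2) \<le> 8 / sqrt r"
    using small_square_sum_outside_top[of P "\<lambda>i. \<alpha> i / s" r] P(2) s r by (auto simp: P_def)
  have "(\<Sum>i\<in>P - I. (\<alpha> i)\<^sup>2) = s\<^sup>2 * (\<Sum>i\<in>P - I. (\<alpha> i / s)\<^sup>2)"
    using s by (simp add: power_divide sum_distrib_left)
  also have "\<dots> \<le> s\<^sup>2 * (8 / sqrt r)" using le by (intro mult_left_mono) auto
  finally have 1: "(\<Sum>i\<in>P - I. (\<alpha> i)\<^sup>2) \<le> 8 * s\<^sup>2 / sqrt r" by (simp add: mult_ac)
  have "(\<Sum>i\<in>V - P. (\<alpha> i)\<^sup>2) \<le> (\<Sum>i\<in>V - P. l\<^sup>2)"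
  proof (rule sum_mono)
    fix i assume "i \<in> V - P"
    then have "\<bar>\<alpha> i\<bar> \<le> \<bar>l\<bar>" using eigenvalue_lower[of i] l_gt_1 by (auto simp: P_def)
    then show "(\<alpha> i)\<^sup>2 \<le> l\<^sup>2" by (rule abs_le_square_iff[THEN iffD1])
  qed
  also have "\<dots> \<le> l\<^sup>2 * s"
    using card_mono[OF fin, of "V - P"] by (simp add: s_def mult.commute[of _ "l\<^sup>2"] mult_left_mono)
  finally have 2: "(\<Sum>i\<in>V - P. (\<alpha> i)\<^sup>2) \<le> l\<^sup>2 * s" .
  have "V - I = (V - P) \<union> (P - I)" "(V - P) \<inter> (P - I) = {}" using I P by auto
  then have "(\<Sum>i\<in>V - I. (\<alpha> i)\<^sup>2) = (\<Sum>i\<in>V - P. (\<alpha> i)\<^sup>2) + (\<Sum>i\<in>P - I. (\<alpha> i)\<^sup>2)"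
    using fin P by (simp add: sum.union_disjoint)
  then show ?thesis using 1 2 I P by (intro that[of I]) (auto simp: P_def s_def)
qed

end

section \<open>Densities of nearly positive semidefinite graphs\<close>

context near_psd_graph
begin

definition deg :: "'a \<Rightarrow> real" where "deg x = (\<Sum>y\<in>V. A x y)"

definition density :: real where "density = (\<Sum>x\<in>V. deg x) / (real (card V))\<^sup>2"

text \<open>The diagonal entry at \<open>v\<close> of the cube of \<open>A\<close>: twice the number
  of edges inside the neighbourhood of \<open>v\<close>.\<close>

definition codeg :: "'a \<Rightarrow> real" where "codeg v = (\<Sum>x\<in>V. \<Sum>y\<in>V. A x y * A v x * A v y)"

lemma A_bounds: "x \<in> V \<Longrightarrow> y \<in> V \<Longrightarrow> 0 \<le> A x y" "x \<in> V \<Longrightarrow> y \<in> V \<Longrightarrow> A x y \<le> 1"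
  using zero_one by fastforce+

lemma deg_bounds: assumes "x \<in> V" shows "0 \<le> deg x" "deg x \<le> real (card V)"
proof -
  show "0 \<le> deg x" unfolding deg_def using assms by (intro sum_nonneg A_bounds)
  have "deg x \<le> (\<Sum>y\<in>V. 1)" unfolding deg_def using assms by (intro sum_mono A_bounds)
  then show "deg x \<le> real (card V)" by simp
qed

text \<open>Splitting \<open>\<alpha>\<^sup>2\<close> as
  \<open>\<alpha>^(3/2) * \<alpha>^(1/2)\<close> bounds the squared second moment over
  \<open>I\<close> by third times first moment. Restriction to \<open>I\<close> costs the subtracted
  tail in the second moment and at most \<open>l^3\<close> in the third.\<close>

lemma local_Cauchy_Schwarz:
  assumes I: "I \<subseteq> V" "\<And>i. i \<in> I \<Longrightarrow> 0 < \<alpha> i" and v: "v \<in> V"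
  shows "(deg v - (\<Sum>i\<in>V - I. (\<alpha> i)\<^sup>2 * (\<phi> i v)\<^sup>2))\<^sup>2 \<le> (codeg v + l^3) * (\<Sum>i\<in>I. \<alpha> i * (\<phi> i v)\<^sup>2)"
proof -
  have split: "(\<Sum>i\<in>V. g i) = (\<Sum>i\<in>I. g i) + (\<Sum>i\<in>V - I. g i)" for g :: "'a \<Rightarrow> real"
    using sum.subset_diff[OF I(1) fin, of g] by simp
  have "deg v = (\<Sum>y\<in>V. (A v y)\<^sup>2)"
    unfolding deg_def using zero_one[OF v] by (intro sum.cong refl) (metis one_power2 zero_power2)
  then have X: "deg v - (\<Sum>i\<in>V - I. (\<alpha> i)\<^sup>2 * (\<phi> i v)\<^sup>2) = (\<Sum>i\<in>I. (\<alpha> i)\<^sup>2 * (\<phi> i v)\<^sup>2)"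
    using split[of "\<lambda>i. (\<alpha> i)\<^sup>2 * (\<phi> i v)\<^sup>2"] local_moment2[OF v] by simp
  have "(\<Sum>i\<in>I. (\<alpha> i)\<^sup>2 * (\<phi> i v)\<^sup>2)\<^sup>2 = (\<Sum>i\<in>I. (\<alpha> i * sqrt (\<alpha> i) * \<phi> i v) * (sqrt (\<alpha> i) * \<phi> i v))\<^sup>2"
  proof (intro arg_cong[where f = "\<lambda>t. t\<^sup>2"] sum.cong refl)
    fix i assume "i \<in> I"
    then have "sqrt (\<alpha> i) * sqrt (\<alpha> i) = \<alpha> i" using I(2)[of i] by simp
    moreover have "(\<alpha> i * sqrt (\<alpha> i) * \<phi> i v) * (sqrt (\<alpha> i) * \<phi> i v) = \<alpha> i * (sqrt (\<alpha> i) * sqrt (\<alpha> i)) * (\<phi> i v)\<^sup>2"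
      by (simp only: power2_eq_square mult_ac)
    ultimately show "(\<alpha> i)\<^sup>2 * (\<phi> i v)\<^sup>2 = (\<alpha> i * sqrt (\<alpha> i) * \<phi> i v) * (sqrt (\<alpha> i) * \<phi> i v)"
      by (simp add: power2_eq_square)
  qed
  also have "\<dots> \<le> (\<Sum>i\<in>I. (\<alpha> i * sqrt (\<alpha> i) * \<phi> i v)\<^sup>2) * (\<Sum>i\<in>I. (sqrt (\<alpha> i) * \<phi> i v)\<^sup>2)"
    by (rule Cauchy_Schwarz_ineq_sum)
  also have "(\<Sum>i\<in>I. (\<alpha> i * sqrt (\<alpha> i) * \<phi> i v)\<^sup>2) = (\<Sum>i\<in>I. (\<alpha> i)^3 * (\<phi> i v)\<^sup>2)"
    using I(2) by (intro sum.cong refl) (simp add: power_mult_distrib power3_eq_cube power2_eq_square less_imp_le)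
  also have "(\<Sum>i\<in>I. (sqrt (\<alpha> i) * \<phi> i v)\<^sup>2) = (\<Sum>i\<in>I. \<alpha> i * (\<phi> i v)\<^sup>2)"
    using I(2) by (intro sum.cong refl) (simp add: power_mult_distrib less_imp_le)
  also have "(\<Sum>i\<in>I. (\<alpha> i)^3 * (\<phi> i v)\<^sup>2) * (\<Sum>i\<in>I. \<alpha> i * (\<phi> i v)\<^sup>2) \<le> (codeg v + l^3) * (\<Sum>i\<in>I. \<alpha> i * (\<phi> i v)\<^sup>2)"
  proof (intro mult_right_mono sum_nonneg)
    have "(\<Sum>i\<in>V - I. - (l^3) * (\<phi> i v)\<^sup>2) \<le> (\<Sum>i\<in>V - I. (\<alpha> i)^3 * (\<phi> i v)\<^sup>2)"
    proof (intro sum_mono mult_right_mono)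
      fix i assume "i \<in> V - I"
      then have "(- l)^3 \<le> (\<alpha> i)^3" using eigenvalue_lower[of i] by (intro power_mono_odd) auto
      then show "- (l^3) \<le> (\<alpha> i)^3" by simp
    qed auto
    moreover have "l^3 * (\<Sum>i\<in>V - I. (\<phi> i v)\<^sup>2) \<le> l^3 * 1"
    proof (rule mult_left_mono)
      have "(\<Sum>i\<in>V - I. (\<phi> i v)\<^sup>2) \<le> (\<Sum>i\<in>V. (\<phi> i v)\<^sup>2)" using fin by (intro sum_mono2) auto
      then show "(\<Sum>i\<in>V - I. (\<phi> i v)\<^sup>2) \<le> 1" using eigenvector_entries[OF v] by simp
    qed (use l_gt_1 in auto)
    ultimately have "- (l^3) \<le> (\<Sum>i\<in>V - I. (\<alpha> i)^3 * (\<phi> i v)\<^sup>2)"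
      by (simp add: sum_distrib_left sum_negf)
    then show "(\<Sum>i\<in>I. (\<alpha> i)^3 * (\<phi> i v)\<^sup>2) \<le> codeg v + l^3"
      using split[of "\<lambda>i. (\<alpha> i)^3 * (\<phi> i v)\<^sup>2"] local_moment3[OF v sym] by (simp add: codeg_def)
  qed (use I(2) in \<open>auto simp: less_imp_le\<close>)
  finally show ?thesis unfolding X .
qed

text \<open>Divided by \<open>(deg v)\<^sup>2\<close> and summed over \<open>v\<close>, the local
  inequality says that 1 is at most about \<open>P\<close> times \<open>\<sigma>(r)\<close>. For
  \<open>p < 72/100\<close> this fails: \<open>P\<close>, about \<open>p powr (3/4)\<close>, is too
  small for the bound on \<open>\<sigma>(r)\<close>.\<close>

lemma density_ge:
  fixes s p m :: real
  defines "s \<equiv> real (card V)" and "p \<equiv> density"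
  defines "m \<equiv> 874/1000 * p * s"
  assumes p0: "0 < p"
    and deg_ge: "\<And>x. x \<in> V \<Longrightarrow> m \<le> deg x"
    and codeg_le: "\<And>x. x \<in> V \<Longrightarrow> codeg x ^ 4 \<le> p^4 * s * deg x ^ 7"
    and l1: "l\<^sup>2 * sqrt s / s \<le> 1/1000" and l2: "l \<le> sqrt s powr (1/200)"
    and l3: "l\<^sup>2 / s \<le> 4/10000 * p" and l4: "l^3 / m\<^sup>2 \<le> p / 1000"
  shows "72/100 \<le> p"
proof (rule ccontr)
  assume "\<not> 72/100 \<le> p"
  then have p1: "p < 72/100" by simp
  have s0: "0 < s" using card_pos by (simp add: s_def)
  have s1: "1 \<le> s" using s0 by (simp add: s_def)
  have m0: "0 < m" using p0 s0 by (simp add: m_def)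
  \<comment> \<open>The growth lemma is used with \<open>Y = sqrt s\<close> and
    \<open>\<eta> = 1/100\<close>; \<open>l1\<close> and \<open>l2\<close> are what it asks of
    \<open>l\<close>.\<close>
  define e where "e = l\<^sup>2 * sqrt s / s"
  have e0: "0 \<le> e" "e \<le> 1/1000" using s0 l1 by (auto simp: e_def)
  \<comment> \<open>Chosen so that \<open>8 * s\<^sup>2 / sqrt r\<close> is at most
    \<open>2/100 * p * s\<^sup>2\<close>. The constant 570 below absorbs the rounding:
    \<open>2 * (400\<^sup>2 + 1) \<le> 570\<^sup>2\<close>.\<close>
  define r where "r = nat \<lceil>(400/p)\<^sup>2\<rceil>"
  have r_ge: "(400/p)\<^sup>2 \<le> real r" unfolding r_def by linarith
  have "real r \<le> (400/p)\<^sup>2 + 1"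
    using of_int_ceiling_le_add_one[of "(400/p)\<^sup>2"] by (simp add: r_def)
  also have "1 \<le> (1/p)\<^sup>2" using p0 p1 by (simp add: one_le_power)
  finally have "2 * real r \<le> 2 * ((400/p)\<^sup>2 + (1/p)\<^sup>2)" by simp
  also have "\<dots> \<le> (570/p)\<^sup>2" by (simp add: power_divide divide_right_mono flip: add_divide_distrib)
  finally have r_le: "2 * real r \<le> (570/p)\<^sup>2" .
  have "1 < (400/p)\<^sup>2" using p0 p1 by (intro one_less_power) auto
  then have r1: "1 \<le> r" using r_ge by linarith
  obtain I where I: "I \<subseteq> V" "\<And>i. i \<in> I \<Longrightarrow> 0 < \<alpha> i" "card I \<le> r"
    and tail: "(\<Sum>i\<in>V - I. (\<alpha> i)\<^sup>2) \<le> l\<^sup>2 * s + 8 * s\<^sup>2 / sqrt r"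
    using few_dominant_eigenvalues[of e "sqrt s" "1/100" r] e0 s1 l2 r1
    unfolding s_def e_def by auto
  \<comment> \<open>\<open>w\<close> carries the dependence on \<open>p\<close>: the growth bound
    contributes \<open>(72/100 / p) powr (1/50) \<le> w\<close>, and the remaining number is at most
    \<open>1144/1000\<close>.\<close>
  define w where "w = sqrt (72/100 / p)"
  have w0: "0 < w" using p0 by (simp add: w_def)
  have w2: "w\<^sup>2 = 72/100 / p" using p0 by (simp add: w_def)
  have top: "(\<Sum>i\<in>I. \<alpha> i) \<le> (1001/1000 * (1144/1000 * w)) * s"
  proof -
    have "(\<Sum>i\<in>I. \<alpha> i) \<le> ((1 + e) * (2 * real r) powr (1/100)) * s"
      using top_sum_le_subset[OF top_sum_le_growth[of e "sqrt s" "1/100" "real r"] I(1)] I(3) e0 s1 l2 r1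
      unfolding s_def e_def by auto
    also have "\<dots> \<le> (1001/1000 * (1144/1000 * w)) * s"
    proof (intro mult_right_mono mult_mono)
      have "(2 * real r) powr (1/100) \<le> ((570/p)\<^sup>2) powr (1/100)" using r_le by (intro powr_mono2) auto
      also have "(570/p)\<^sup>2 = (570/p) powr 2" using p0 by simp
      also have "((570/p) powr 2) powr (1/100) = (570/p) powr (1/50)" unfolding powr_powr by simp
      also have "570/p = (570/(72/100)) * (72/100/p)" by simp
      also have "\<dots> powr (1/50) = (570/(72/100)) powr (1/50) * (72/100/p) powr (1/50)"
        by (rule powr_mult)
      also have "\<dots> \<le> ((1144/1000) ^ 50) powr (1/50) * (72/100/p) powr (1/2)"
        using p0 p1 by (intro mult_mono powr_mono2 powr_mono) (auto simp: field_simps)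
      also have "((1144/1000) ^ 50) powr (1/50) = ((1144/1000 :: real) powr 50) powr (1/50)" by simp
      also have "\<dots> = 1144/1000" unfolding powr_powr by simp
      finally show "(2 * real r) powr (1/100) \<le> 1144/1000 * w" using p0 by (simp add: w_def powr_half_sqrt)
    qed (use e0 s0 in auto)
    finally show ?thesis .
  qed
  \<comment> \<open>Since \<open>p * s = m / (874/1000)\<close> and \<open>m \<le> deg v\<close>,
    the hypothesis \<open>codeg_le\<close> becomes
    \<open>codeg v ^ 4 \<le> P^4 * deg v ^ 8\<close>.\<close>
  define P where "P = root 4 (p^3 / (874/1000))"
  have P: "0 \<le> P" "P^4 = p^3 / (874/1000)" using p0 by (auto simp: P_def)
  have codeg_le': "codeg v \<le> P * (deg v)\<^sup>2" if v: "v \<in> V" for v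
  proof (rule power_le_imp_le_base[of _ 3])
    have "codeg v ^ 4 \<le> p^4 * s * deg v ^ 7" using codeg_le[OF v] .
    also have "\<dots> = p^3 / (874/1000) * m * deg v ^ 7" by (simp add: m_def power_numeral_reduce)
    also have "\<dots> \<le> p^3 / (874/1000) * deg v * deg v ^ 7"
      using p0 deg_bounds[OF v] deg_ge[OF v] by (intro mult_right_mono mult_left_mono) auto
    also have "\<dots> = (P * (deg v)\<^sup>2) ^ 4" by (simp only: power_mult_distrib P(2)) (simp add: power_numeral_reduce)
    finally show "codeg v ^ Suc 3 \<le> (P * (deg v)\<^sup>2) ^ Suc 3" by simp
  qed (use P in auto)
  define tl where "tl v = (\<Sum>i\<in>V - I. (\<alpha> i)\<^sup>2 * (\<phi> i v)\<^sup>2)" for v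
  define lc where "lc v = (\<Sum>i\<in>I. \<alpha> i * (\<phi> i v)\<^sup>2)" for v
  \<comment> \<open>After division the left side is \<open>(1 - t)\<^sup>2 \<ge> 1 - 2 * t\<close>
    with \<open>t = tl v / deg v\<close>.\<close>
  have loc: "1 - 2 * (tl v / m) \<le> (P + p/1000) * lc v" if v: "v \<in> V" for v
  proof -
    have d0: "0 < deg v" "m \<le> deg v" using deg_ge[OF v] m0 by auto
    have lc0: "0 \<le> lc v" unfolding lc_def using I(2) by (intro sum_nonneg) (auto simp: less_imp_le)
    have tl0: "0 \<le> tl v" unfolding tl_def by (intro sum_nonneg) auto
    have "(deg v - tl v)\<^sup>2 \<le> (codeg v + l^3) * lc v"
      using local_Cauchy_Schwarz[OF I(1,2) v] by (simp add: tl_def lc_def)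
    also have "\<dots> \<le> (P * (deg v)\<^sup>2 + p/1000 * (deg v)\<^sup>2) * lc v"
    proof (intro mult_right_mono add_mono codeg_le' v lc0)
      have "l^3 \<le> p/1000 * m\<^sup>2" using l4 m0 by (simp add: pos_divide_le_eq)
      also have "\<dots> \<le> p/1000 * (deg v)\<^sup>2" using p0 m0 d0 by (intro mult_left_mono power_mono) auto
      finally show "l^3 \<le> p/1000 * (deg v)\<^sup>2" .
    qed
    finally have "(deg v - tl v)\<^sup>2 / (deg v)\<^sup>2 \<le> (P + p/1000) * lc v"
      using d0 by (simp add: pos_divide_le_eq algebra_simps)
    moreover have "1 - 2 * (tl v / deg v) \<le> (deg v - tl v)\<^sup>2 / (deg v)\<^sup>2"
    proof -
      have "(deg v - tl v)\<^sup>2 / (deg v)\<^sup>2 = (1 - tl v / deg v)\<^sup>2"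
        using d0 by (simp add: diff_divide_distrib flip: power_divide)
      then show ?thesis by (simp add: power2_diff)
    qed
    moreover have "tl v / deg v \<le> tl v / m" using tl0 m0 d0 by (intro divide_left_mono) auto
    ultimately show ?thesis by linarith
  qed
  \<comment> \<open>Eigenvectors are normalised, so summing over \<open>v\<close> turns the local
    moments into plain sums over eigenvalues.\<close>
  have norm: "(\<Sum>v\<in>V. (\<phi> i v)\<^sup>2) = 1" if "i \<in> V" for i
    using orthonormal[OF that that] by (simp add: power2_eq_square)
  have sum_lc: "(\<Sum>v\<in>V. lc v) = (\<Sum>i\<in>I. \<alpha> i)"
    unfolding lc_def by (subst sum.swap) (use I(1) norm in \<open>auto intro!: sum.cong simp flip: sum_distrib_left\<close>)
  have sum_tl: "(\<Sum>v\<in>V. tl v) = (\<Sum>i\<in>V - I. (\<alpha> i)\<^sup>2)"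
    unfolding tl_def by (subst sum.swap) (use norm in \<open>auto intro!: sum.cong simp flip: sum_distrib_left\<close>)
  have "s - 2 * ((\<Sum>v\<in>V. tl v) / m) = (\<Sum>v\<in>V. 1 - 2 * (tl v / m))"
    by (simp add: sum_subtractf s_def sum_divide_distrib sum_distrib_left)
  also have "\<dots> \<le> (\<Sum>v\<in>V. (P + p/1000) * lc v)" by (intro sum_mono loc)
  also have "\<dots> = (P + p/1000) * (\<Sum>i\<in>I. \<alpha> i)" by (simp add: sum_lc flip: sum_distrib_left)
  also have "\<dots> \<le> (P + p/1000) * ((1001/1000 * (1144/1000 * w)) * s)"
    using P p0 by (intro mult_left_mono top) auto
  finally have main: "s - 2 * ((\<Sum>v\<in>V. tl v) / m) \<le> (P + p/1000) * ((1001/1000 * (1144/1000 * w)) * s)" .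
  have sr: "400/p \<le> sqrt r" by (rule real_le_rsqrt[OF r_ge])
  have "8 * s\<^sup>2 / sqrt r \<le> 8 * s\<^sup>2 / (400/p)"
    using r1 p0 by (intro divide_left_mono sr) auto
  then have "(\<Sum>v\<in>V. tl v) \<le> (l\<^sup>2 / s) * s\<^sup>2 + 2/100 * p * s\<^sup>2"
    using tail s0 unfolding sum_tl by (simp add: power2_eq_square)
  also have "\<dots> \<le> (4/10000 * p) * s\<^sup>2 + 2/100 * p * s\<^sup>2"
    by (intro add_mono mult_right_mono l3) (use p0 in auto)
  also have "\<dots> = (204/10000 / (874/1000)) * s * m" by (simp add: m_def power2_eq_square)
  finally have "(\<Sum>v\<in>V. tl v) / m \<le> (204/10000 / (874/1000)) * s" using m0 by (simp add: pos_divide_le_eq)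
  then have "(1 - 2 * (204/10000 / (874/1000))) * s \<le> s - 2 * ((\<Sum>v\<in>V. tl v) / m)" by simp
  then have "(1 - 2 * (204/10000 / (874/1000))) * s \<le> ((P + p/1000) * (1001/1000 * (1144/1000 * w))) * s"
    using main unfolding mult.assoc by linarith
  then have "1 - 2 * (204/10000 / (874/1000)) \<le> (P + p/1000) * (1001/1000 * (1144/1000 * w))"
    using s0 by (rule mult_right_le_imp_le)
  \<comment> \<open>The left side exceeds 0.953, the right side stays below 0.93. The bound on
    \<open>P * w\<close> is taken at \<open>p = 72/100\<close> because \<open>(P * w)^4\<close> is a
    constant times \<open>p\<close>.\<close>
  also have "\<dots> = 1001/1000 * (1144/1000) * (P * w + p * w / 1000)" by (simp add: algebra_simps)
  also have "\<dots> \<le> 1001/1000 * (1144/1000) * (81/100 + 1/1000)"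
  proof (intro mult_left_mono add_mono)
    show "P * w \<le> 81/100"
    proof (rule power_le_imp_le_base[of _ 3])
      have "(P * w)^4 = P^4 * (w\<^sup>2)\<^sup>2" by (simp add: power_mult_distrib flip: power_mult)
      also have "\<dots> = p * ((72/100)\<^sup>2 / (874/1000))" unfolding P w2 using p0
        by (simp add: power2_eq_square power3_eq_cube)
      also have "\<dots> \<le> 72/100 * ((72/100)\<^sup>2 / (874/1000))" using p1 by (intro mult_right_mono) auto
      also have "\<dots> \<le> (81/100)^4" by (simp add: power4_eq_xxxx power2_eq_square)
      finally show "(P * w) ^ Suc 3 \<le> (81/100) ^ Suc 3" by simp
    qed simp
    have "(p * w)\<^sup>2 = p * (72/100)" unfolding power_mult_distrib w2 using p0 by (simp add: power2_eq_square)
    also have "\<dots> \<le> 1\<^sup>2" using p1 by simp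
    finally have "p * w \<le> 1" by (rule power2_le_imp_le) simp
    then show "p * w / 1000 \<le> 1/1000" by simp
  qed auto
  finally show False by simp
qed

text \<open>Edges gain at most about \<open>2 * g * s\<^sup>2 * (1 - p)\<close> in the sum of the
  13th powers, whereas non-edges lose about \<open>b * s\<^sup>2 * (1 - p)\<close>. The exponent is
  odd, so non-edges count negatively, and large enough for \<open>2 * g < b\<close>.\<close>

lemma density_close_to_one:
  fixes s p :: real
  defines "s \<equiv> real (card V)" and "p \<equiv> density"
  assumes p: "72/100 \<le> p" and deg_ge: "\<And>x. x \<in> V \<Longrightarrow> 874/1000 * p * s \<le> deg x" and l: "l / s \<le> p / 1000"
  shows "1 - p \<le> 20000 * l^13 / s"
proof -
  have s0: "0 < s" using card_pos by (simp add: s_def)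
  define D where "D = (\<Sum>x\<in>V. deg x)"
  have D: "D = p * s\<^sup>2" using s0 by (simp add: p_def density_def D_def s_def)
  define T where "T = D + l * s"
  have T: "T = (p + l / s) * s\<^sup>2" using s0 by (simp add: T_def D field_simps power2_eq_square)
  have T0: "0 < T" unfolding T using s0 p l_gt_1 by (intro mult_pos_pos add_pos_pos) auto
  have l13: "l \<le> l^13" using power_increasing[of 1 13 l] l_gt_1 by simp
  \<comment> \<open>If \<open>T > s\<^sup>2\<close>, then \<open>p + l / s > 1\<close> already
    suffices. Otherwise \<open>T \<le> s\<^sup>2\<close> bounds \<open>a x * a y / T\<close> below
    by the product of the normalised degrees.\<close>
  show ?thesis
  proof (cases "T \<le> s\<^sup>2")
    case False
    then have "1 * s\<^sup>2 < (p + l / s) * s\<^sup>2" unfolding T by simp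
    then have "1 < p + l / s" by (rule mult_right_less_imp_less) simp
    then have "1 - p \<le> l / s" by simp
    also have "\<dots> \<le> 20000 * l^13 / s" using s0 l13 l_gt_1 by (intro divide_right_mono) auto
    finally show ?thesis .
  next
    case Ts: True
    define a where "a x = deg x + l" for x
    define B where "B x y = A x y + l * of_bool (x = y)" for x y
    define M where "M x y = B x y - a x * a y / T" for x y
    have Brow: "(\<Sum>y\<in>V. B x y) = a x" if "x \<in> V" for x
      using that fin by (simp add: B_def a_def deg_def sum.distrib flip: sum_distrib_left)
    have Bsym: "B x y = B y x" if "x \<in> V" "y \<in> V" for x y using sym[OF that] by (auto simp: B_def)
    have suma: "(\<Sum>x\<in>V. a x) = T" by (simp add: a_def T_def D_def s_def sum.distrib)
    \<comment> \<open>Completing the square: the form of \<open>B\<close> at \<open>y - c\<close>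
      with \<open>c = u / T\<close> is the form of \<open>M\<close> at \<open>y\<close>.\<close>
    have psdM: "psd_on V M"
      unfolding psd_on_def
    proof
      fix y :: "'a \<Rightarrow> real"
      define u where "u = (\<Sum>x\<in>V. a x * y x)"
      define c where "c = u / T"
      have r1: "(\<Sum>x\<in>V. \<Sum>z\<in>V. B x z * y x) = u"
        by (simp add: u_def Brow flip: sum_distrib_right)
      have "(\<Sum>x\<in>V. \<Sum>z\<in>V. B x z * y z) = (\<Sum>z\<in>V. \<Sum>x\<in>V. B z x * y z)"
        by (subst sum.swap) (intro sum.cong refl, metis Bsym)
      then have r2: "(\<Sum>x\<in>V. \<Sum>z\<in>V. B x z * y z) = u" using r1 by simp
      have r3: "(\<Sum>x\<in>V. \<Sum>z\<in>V. B x z) = T" by (simp add: Brow suma)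
      have r4: "(\<Sum>x\<in>V. \<Sum>z\<in>V. (a x * y x) * (a z * y z)) = u\<^sup>2"
        by (simp add: u_def power2_eq_square sum_product)
      have "0 \<le> (\<Sum>x\<in>V. \<Sum>z\<in>V. B x z * (y x - c) * (y z - c))"
        using spec[OF psd[unfolded psd_on_def], of "\<lambda>x. y x - c"] by (simp add: B_def)
      also have "\<dots> = (\<Sum>x\<in>V. \<Sum>z\<in>V. B x z * y x * y z) - c * (\<Sum>x\<in>V. \<Sum>z\<in>V. B x z * y x)
          - c * (\<Sum>x\<in>V. \<Sum>z\<in>V. B x z * y z) + c\<^sup>2 * (\<Sum>x\<in>V. \<Sum>z\<in>V. B x z)"
        unfolding sum_distrib_left sum_subtractf[symmetric] sum.distrib[symmetric]
        by (intro sum.cong refl) (simp add: algebra_simps power2_eq_square)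
      also have "\<dots> = (\<Sum>x\<in>V. \<Sum>z\<in>V. B x z * y x * y z) - u\<^sup>2 / T"
        unfolding r1 r2 r3 c_def using T0 by (simp add: field_simps power2_eq_square)
      also have "\<dots> = (\<Sum>x\<in>V. \<Sum>z\<in>V. M x z * y x * y z)"
        unfolding r4[symmetric] sum_divide_distrib sum_subtractf[symmetric] M_def
        by (intro sum.cong refl) (simp add: algebra_simps)
      finally show "0 \<le> (\<Sum>x\<in>V. \<Sum>z\<in>V. M x z * y x * y z)" .
    qed
    have "psd_on V (\<lambda>x y. M x y ^ Suc 12)"
      by (rule psd_on_Schur_power[OF fin _ psdM]) (simp add: M_def Bsym mult.commute)
    then have pos: "0 \<le> (\<Sum>x\<in>V. \<Sum>y\<in>V. M x y ^ 13)"
      unfolding psd_on_def by (auto dest!: spec[of _ "\<lambda>_. 1"])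
    define q where "q x = 1 - deg x / s" for x
    have q0: "0 \<le> q x" if "x \<in> V" for x using deg_bounds[OF that] s0 by (simp add: q_def s_def)
    have sumq: "(\<Sum>x\<in>V. q x) = s * (1 - p)"
      using s0 D by (simp add: q_def sum_subtractf s_def D_def power2_eq_square algebra_simps flip: sum_divide_distrib)
    \<comment> \<open>For an edge, twelve of the 13 factors \<open>1 - \<beta>\<close> are bounded
      by \<open>46/100\<close> and the last by \<open>q x + q y\<close>; \<open>b\<close> is the
      least loss at a non-edge.\<close>
    define g b :: real where "g = (46/100)^12" and "b = (54/100)^13"
    \<comment> \<open>\<open>54/100\<close> is below
      \<open>(874/1000)\<^sup>2 * p / (1 + 1/1000)\<close> for \<open>p \<ge> 72/100\<close>; the
      second part rests on \<open>(1 - q x) * (1 - q y) \<ge> 1 - q x - q y\<close>.\<close>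
    have beta: "54/100 \<le> a x * a y / T" "1 - a x * a y / T \<le> q x + q y" if xy: "x \<in> V" "y \<in> V" for x y
    proof -
      have mp: "0 \<le> 874/1000 * p * s" using p s0 by simp
      have "54/100 * T \<le> 54/100 * ((p + p/1000) * s\<^sup>2)"
        unfolding T using l by (intro mult_left_mono mult_right_mono) auto
      also have "\<dots> \<le> (874/1000)\<^sup>2 * p * p * s\<^sup>2"
        using p s0 by (auto simp: power2_eq_square)
      also have "\<dots> = (874/1000 * p * s) * (874/1000 * p * s)" by (simp add: power2_eq_square)
      also have "\<dots> \<le> a x * a y"
        using deg_ge[OF xy(1)] deg_ge[OF xy(2)] l_gt_1 mp by (intro mult_mono) (auto simp: a_def)
      finally show "54/100 \<le> a x * a y / T" using T0 by (simp add: pos_le_divide_eq)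
      have "1 - q x - q y \<le> (1 - q x) * (1 - q y)"
        using q0[OF xy(1)] q0[OF xy(2)] by (simp add: algebra_simps)
      also have "\<dots> = deg x * deg y / s\<^sup>2" by (simp add: q_def power2_eq_square)
      also have "\<dots> \<le> a x * a y / s\<^sup>2"
        using deg_bounds[OF xy(1)] deg_bounds[OF xy(2)] l_gt_1
        by (intro divide_right_mono mult_mono) (auto simp: a_def)
      also have "\<dots> \<le> a x * a y / T"
        using Ts T0 deg_bounds[OF xy(1)] deg_bounds[OF xy(2)] l_gt_1 s0
        by (intro divide_left_mono mult_nonneg_nonneg) (auto simp: a_def)
      finally show "1 - a x * a y / T \<le> q x + q y" by simp
    qed
    have g0: "0 \<le> g" by (simp add: g_def)
    have entry: "M x y ^ 13 \<le> of_bool (x = y) * l^13 + g * (q x + q y) - b * (1 - A x y - of_bool (x = y))"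
      if xy: "x \<in> V" "y \<in> V" for x y
    proof -
      define \<beta> where "\<beta> = a x * a y / T"
      have \<beta>: "54/100 \<le> \<beta>" "1 - \<beta> \<le> q x + q y" using beta[OF xy] by (auto simp: \<beta>_def)
      have gq: "0 \<le> g * (q x + q y)" using g0 q0[OF xy(1)] q0[OF xy(2)] by simp
      consider "x = y" | "x \<noteq> y" "A x y = 1" | "x \<noteq> y" "A x y = 0" using zero_one[OF xy] by blast
      then show ?thesis
      proof cases
        case 1
        then have "M x y = l - \<beta>" using no_loops[OF xy(1)] by (simp add: M_def B_def \<beta>_def)
        then have "M x y \<le> l" using \<beta> by simp
        then have "M x y ^ 13 \<le> l ^ 13" by (intro power_mono_odd) auto
        then show ?thesis using 1 no_loops[OF xy(1)] gq by simp
      next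
        case 2
        then have M: "M x y = 1 - \<beta>" by (simp add: M_def B_def \<beta>_def)
        have "M x y ^ 13 \<le> g * (q x + q y)"
        proof (cases "0 \<le> 1 - \<beta>")
          case True
          have "(1 - \<beta>) ^ 12 * (1 - \<beta>) \<le> g * (q x + q y)"
            unfolding g_def using True \<beta> by (intro mult_mono power_mono) auto
          then show ?thesis unfolding M by (simp add: power_Suc2[symmetric])
        next
          case False
          then have "(1 - \<beta>)^13 \<le> 0" using power_mono_odd[of 13 "1 - \<beta>" 0] by simp
          then show ?thesis using gq unfolding M by linarith
        qed
        then show ?thesis using 2 by simp
      next
        case 3
        then have "M x y = - \<beta>" by (simp add: M_def B_def \<beta>_def)
        then have "M x y \<le> - (54/100)" using \<beta> by simp
        then have "M x y ^ 13 \<le> (- (54/100)) ^ 13" by (intro power_mono_odd) auto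
        then have "M x y ^ 13 \<le> - b" by (simp add: b_def)
        then show ?thesis using 3 gq by simp
      qed
    qed
    have "0 \<le> (\<Sum>x\<in>V. \<Sum>y\<in>V. of_bool (x = y) * l^13 + g * (q x + q y) - b * (1 - A x y - of_bool (x = y)))"
      using pos by (rule order_trans) (intro sum_mono entry)
    also have "\<dots> = (\<Sum>x\<in>V. l^13 + g * (s * q x + s * (1 - p)) - b * (s - deg x - 1))"
    proof (intro sum.cong refl)
      fix x assume x: "x \<in> V"
      have "(\<Sum>y\<in>V. of_bool (x = y) * l^13 + g * (q x + q y) - b * (1 - A x y - of_bool (x = y))) =
        (\<Sum>y\<in>V. of_bool (x = y) * l^13) + g * ((\<Sum>y\<in>V. q x) + (\<Sum>y\<in>V. q y)) - b * ((\<Sum>y\<in>V. 1) - (\<Sum>y\<in>V. A x y) - (\<Sum>y\<in>V. of_bool (x = y) * 1))"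
        unfolding sum_distrib_left sum_subtractf[symmetric] sum.distrib[symmetric] by simp
      also have "\<dots> = l^13 + g * (s * q x + s * (1 - p)) - b * (s - deg x - 1)"
        unfolding sum_delta'[OF x] sumq by (simp add: s_def deg_def)
      finally show "(\<Sum>y\<in>V. of_bool (x = y) * l^13 + g * (q x + q y) - b * (1 - A x y - of_bool (x = y))) = \<dots>" .
    qed
    also have "\<dots> = s * l^13 + g * (s * (\<Sum>x\<in>V. q x) + s * (s * (1 - p))) - b * (s * s - D - s)"
      by (simp add: sum_subtractf sum.distrib s_def D_def algebra_simps flip: sum_distrib_left sum_distrib_right)
    also have "\<dots> = s * (l^13 + 2 * g * s * (1 - p) - b * (s * (1 - p) - 1))"
      unfolding sumq D by (simp add: algebra_simps power2_eq_square)
    finally have "0 \<le> l^13 + 2 * g * s * (1 - p) - b * (s * (1 - p) - 1)"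
      using s0 by (simp add: zero_le_mult_iff)
    then have "(b - 2 * g) * (s * (1 - p)) \<le> l^13 + b" by (simp add: algebra_simps)
    also have "\<dots> \<le> 2 * l^13" using l13 l_gt_1 by (simp add: b_def)
    finally have *: "(b - 2 * g) * (s * (1 - p)) \<le> 2 * l^13" .
    have p_le: "p \<le> 1"
    proof -
      have "D \<le> (\<Sum>x\<in>V. s)" unfolding D_def s_def by (intro sum_mono deg_bounds)
      then have "p * s\<^sup>2 \<le> 1 * s\<^sup>2" by (simp add: D s_def power2_eq_square)
      then show ?thesis using s0 by simp
    qed
    have "1/10000 \<le> b - 2 * g" by (simp add: b_def g_def power_divide)
    then have "1/10000 * (s * (1 - p)) \<le> (b - 2 * g) * (s * (1 - p))"
      using s0 p_le by (intro mult_right_mono) auto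
    then have "s * (1 - p) \<le> 20000 * l^13" using * by simp
    then show ?thesis using s0 by (simp add: pos_le_divide_eq mult.commute)
  qed
qed

end

section \<open>Surplus and positive semidefiniteness\<close>

definition adj :: "'a set set \<Rightarrow> 'a \<Rightarrow> 'a \<Rightarrow> real" where
  "adj E x y = of_bool ({x, y} \<in> E \<and> x \<noteq> y)"

definition weight :: "('a \<Rightarrow> 'a \<Rightarrow> real) \<Rightarrow> 'a set \<Rightarrow> real" where
  "weight A S = (\<Sum>x\<in>S. \<Sum>y\<in>S. A x y)"

lemma adj_commute: "adj E x y = adj E y x"
  by (simp add: adj_def insert_commute eq_commute)

lemma weight_adj:
  assumes G: "simple_graph V E" and S: "S \<subseteq> V"
  shows "weight (adj E) S = 2 * real (card {e \<in> E. e \<subseteq> S})"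
proof -
  define ES where "ES = {e \<in> E. e \<subseteq> S}"
  have finS: "finite S" using G S by (auto simp: simple_graph_def intro: finite_subset)
  have finE: "finite ES" using simple_graph_finite_edges[OF G] by (simp add: ES_def)
  have "weight (adj E) S = (\<Sum>x\<in>S. \<Sum>y\<in>S. \<Sum>e\<in>ES. of_bool (e = {x, y} \<and> x \<noteq> y))"
    unfolding weight_def
  proof (intro sum.cong refl)
    fix x y assume "x \<in> S" "y \<in> S"
    then have "{x, y} \<in> ES \<longleftrightarrow> {x, y} \<in> E" by (auto simp: ES_def)
    moreover have "(\<Sum>e\<in>ES. of_bool (e = {x, y} \<and> x \<noteq> y)) = (\<Sum>e\<in>ES. if e = {x, y} then of_bool (x \<noteq> y) else (0::real))"
      by (intro sum.cong) auto
    ultimately show "adj E x y = (\<Sum>e\<in>ES. of_bool (e = {x, y} \<and> x \<noteq> y))"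
      using finE by (simp add: adj_def)
  qed
  also have "\<dots> = (\<Sum>e\<in>ES. \<Sum>x\<in>S. \<Sum>y\<in>S. of_bool (e = {x, y} \<and> x \<noteq> y))" by (rule sum_rotate)
  also have "\<dots> = (\<Sum>e\<in>ES. 2)"
  proof (intro sum.cong refl)
    fix e assume e: "e \<in> ES"
    then obtain u v where uv: "u \<noteq> v" "e = {u, v}" using G by (auto simp: ES_def simple_graph_def)
    have uvS: "u \<in> S" "v \<in> S" using e uv by (auto simp: ES_def)
    have "(\<Sum>x\<in>S. \<Sum>y\<in>S. of_bool (e = {x, y} \<and> x \<noteq> y)) = (\<Sum>x\<in>S. (\<Sum>y\<in>S. if y = v then of_bool (x = u) else 0) + (\<Sum>y\<in>S. if y = u then of_bool (x = v) else (0::real)))"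
      unfolding sum.distrib[symmetric]
      by (intro sum.cong refl) (use uv in \<open>auto simp: doubleton_eq_iff\<close>)
    also have "\<dots> = (\<Sum>x\<in>S. if x = u then 1 else 0) + (\<Sum>x\<in>S. if x = v then 1 else 0)"
      using uvS finS by (simp add: sum.distrib of_bool_def)
    also have "\<dots> = 2" using uvS finS by (simp only: sum.delta) simp
    finally show "(\<Sum>x\<in>S. \<Sum>y\<in>S. of_bool (e = {x, y} \<and> x \<noteq> y)) = (2::real)" .
  qed
  finally show ?thesis by (simp add: ES_def)
qed

text \<open>With zero diagonal the form is affine in each coordinate: its value at
  \<open>y w = t\<close> is the average of those at 1 and -1 with weights \<open>(1 + t) / 2\<close>
  and \<open>(1 - t) / 2\<close>, so one of the two is no larger.\<close>

lemma quadratic_form_ge_sign_vector: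
  fixes A :: "'a \<Rightarrow> 'a \<Rightarrow> real"
  assumes "finite V" and no_loops: "\<And>v. v \<in> V \<Longrightarrow> A v v = 0"
    and x: "\<And>v. v \<in> V \<Longrightarrow> \<bar>x v\<bar> \<le> 1"
  obtains \<epsilon> where "\<And>v. v \<in> V \<Longrightarrow> \<epsilon> v = 1 \<or> \<epsilon> v = -1"
    "(\<Sum>u\<in>V. \<Sum>v\<in>V. A u v * \<epsilon> u * \<epsilon> v) \<le> (\<Sum>u\<in>V. \<Sum>v\<in>V. A u v * x u * x v)"
proof -
  define Q where "Q y = (\<Sum>u\<in>V. \<Sum>v\<in>V. A u v * y u * y v)" for y :: "'a \<Rightarrow> real"
  have "\<exists>y. (\<forall>v\<in>W. y v = 1 \<or> y v = -1) \<and> (\<forall>v\<in>V. \<bar>y v\<bar> \<le> 1) \<and> Q y \<le> Q x" if "finite W" "W \<subseteq> V" for W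
    using that
  proof (induction W)
    case empty
    then show ?case using x by auto
  next
    case (insert w W)
    then obtain y where y: "\<forall>v\<in>W. y v = 1 \<or> y v = -1" "\<forall>v\<in>V. \<bar>y v\<bar> \<le> 1" "Q y \<le> Q x" by auto
    define t where "t = y w"
    have t: "-1 \<le> t" "t \<le> 1" using y(2) insert.prems by (auto simp: t_def abs_le_iff)
    have "Q y = (1 + t) / 2 * Q (y(w := 1)) + (1 - t) / 2 * Q (y(w := -1))"
      unfolding Q_def sum_distrib_left sum.distrib[symmetric]
    proof (intro sum.cong refl)
      fix u v assume uv: "u \<in> V" "v \<in> V"
      consider "u = w" "v = w" | "u = w" "v \<noteq> w" | "u \<noteq> w" "v = w" | "u \<noteq> w" "v \<noteq> w" by blast
      then show "A u v * y u * y v = (1 + t) / 2 * (A u v * (y(w := 1)) u * (y(w := 1)) v) + (1 - t) / 2 * (A u v * (y(w := -1)) u * (y(w := -1)) v)"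
        by cases (use uv no_loops in \<open>auto simp: t_def field_simps\<close>)
    qed
    moreover have "(1 + t) / 2 * min (Q (y(w := 1))) (Q (y(w := -1))) \<le> (1 + t) / 2 * Q (y(w := 1))"
      "(1 - t) / 2 * min (Q (y(w := 1))) (Q (y(w := -1))) \<le> (1 - t) / 2 * Q (y(w := -1))"
      using t by (auto intro!: mult_left_mono)
    moreover have "(1 + t) / 2 * M + (1 - t) / 2 * M = M" for M :: real by (simp add: field_simps)
    ultimately have "min (Q (y(w := 1))) (Q (y(w := -1))) \<le> Q y"
      by (metis add_mono)
    then consider "Q (y(w := 1)) \<le> Q x" | "Q (y(w := -1)) \<le> Q x" using y(3) by (auto simp: min_le_iff_disj)
    then show ?case
    proof cases
      case 1
      moreover have "\<forall>v\<in>insert w W. (y(w := 1)) v = 1 \<or> (y(w := 1)) v = -1" "\<forall>v\<in>V. \<bar>(y(w := 1)) v\<bar> \<le> 1"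
        using y by auto
      ultimately show ?thesis by blast
    next
      case 2
      moreover have "\<forall>v\<in>insert w W. (y(w := -1)) v = 1 \<or> (y(w := -1)) v = -1" "\<forall>v\<in>V. \<bar>(y(w := -1)) v\<bar> \<le> 1"
        using y by auto
      ultimately show ?thesis by blast
    qed
  qed
  from this[OF assms(1) subset_refl] show ?thesis using that by (auto simp: Q_def)
qed

text \<open>The two sign classes give a cut \<open>F\<close>, the form equals
  \<open>2 * card E - 4 * card F\<close>, and \<open>card F \<le> mc V E\<close>.\<close>

lemma sign_form_ge_surplus:
  assumes G: "simple_graph V E" and \<epsilon>: "\<And>v. v \<in> V \<Longrightarrow> \<epsilon> v = 1 \<or> \<epsilon> v = (-1::real)"
  shows "- 4 * sp V E \<le> (\<Sum>u\<in>V. \<Sum>v\<in>V. adj E u v * \<epsilon> u * \<epsilon> v)"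
proof -
  define F where "F = {e \<in> E. \<exists>a\<in>V. \<exists>b\<in>V. \<epsilon> a = 1 \<and> \<epsilon> b = -1 \<and> e = {a, b}}"
  have GF: "simple_graph V F" using G by (auto simp: simple_graph_def F_def)
  have "subgraph V F V E" using GF by (auto simp: subgraph_def F_def)
  moreover have "bipartite V F" unfolding bipartite_def
  proof (intro exI conjI ballI)
    fix e assume "e \<in> F"
    then obtain a b where "a \<in> V" "b \<in> V" "\<epsilon> a = 1" "\<epsilon> b = -1" "e = {a, b}" by (auto simp: F_def)
    then show "\<exists>a\<in>{v \<in> V. \<epsilon> v = 1}. \<exists>b\<in>{v \<in> V. \<epsilon> v \<noteq> 1}. e = {a, b}"
      by (intro bexI[of _ a] bexI[of _ b]) auto
  qed auto
  ultimately have mc: "card F \<le> mc V E"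
    unfolding mc_def using mc_set_finite_nonempty(1)[OF G] by (intro Max_ge) auto
  have edges: "{e \<in> E. e \<subseteq> V} = E" "{e \<in> F. e \<subseteq> V} = F"
    using G GF by (auto simp: simple_graph_def)
  have "adj E u v * \<epsilon> u * \<epsilon> v = adj E u v - 2 * adj F u v" if "u \<in> V" "v \<in> V" for u v
  proof (cases "{u, v} \<in> E \<and> u \<noteq> v")
    case True
    then have "{u, v} \<in> F \<longleftrightarrow> \<epsilon> u \<noteq> \<epsilon> v"
      using \<epsilon>[OF that(1)] \<epsilon>[OF that(2)] that by (auto simp: F_def doubleton_eq_iff)
    then show ?thesis using True \<epsilon>[OF that(1)] \<epsilon>[OF that(2)] by (auto simp: adj_def)
  next
    case False
    then show ?thesis by (auto simp: adj_def F_def)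
  qed
  then have "(\<Sum>u\<in>V. \<Sum>v\<in>V. adj E u v * \<epsilon> u * \<epsilon> v) = weight (adj E) V - 2 * weight (adj F) V"
    unfolding weight_def sum_distrib_left sum_subtractf[symmetric] by (intro sum.cong refl) auto
  also have "\<dots> = 2 * real (card E) - 4 * real (card F)"
    unfolding weight_adj[OF G subset_refl] weight_adj[OF GF subset_refl] edges by simp
  finally show ?thesis using mc by (simp add: sp_def)
qed

lemma psd_on_subset:
  assumes "psd_on U M" "S \<subseteq> U" "finite U"
  shows "psd_on S M"
  unfolding psd_on_def
proof
  fix y :: "'a \<Rightarrow> real"
  define y' where "y' v = (if v \<in> S then y v else 0)" for v
  have "(\<Sum>x\<in>U. \<Sum>z\<in>U. M x z * y' x * y' z) = (\<Sum>x\<in>S. \<Sum>z\<in>S. M x z * y x * y z)"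
  proof (rule sum.mono_neutral_cong_right)
    fix x assume "x \<in> S"
    then show "(\<Sum>z\<in>U. M x z * y' x * y' z) = (\<Sum>z\<in>S. M x z * y x * y z)"
      using assms by (intro sum.mono_neutral_cong_right) (auto simp: y'_def)
  qed (use assms in \<open>auto simp: y'_def\<close>)
  moreover have "0 \<le> (\<Sum>x\<in>U. \<Sum>z\<in>U. M x z * y' x * y' z)" using assms(1) by (auto simp: psd_on_def)
  ultimately show "0 \<le> (\<Sum>x\<in>S. \<Sum>z\<in>S. M x z * y x * y z)" by simp
qed

text \<open>The coordinates in which a maximiser of \<open>- x\<^sup>T A x - l |x|\<^sup>2\<close> over the cube is not \<open>\<pm>1\<close> are unconstrained,
  so the second order condition makes \<open>A + l I\<close> positive semidefinite on them; the other coordinates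
  are few because each of them costs \<open>l\<close>.\<close>

lemma psd_after_deletion:
  assumes G: "simple_graph V E" and l: "0 < l"
  obtains U where "U \<subseteq> V" "psd_on U (\<lambda>x y. adj E x y + l * of_bool (x = y))"
    "l * real (card (V - U)) \<le> 4 * sp V E"
proof -
  have fin: "finite V" using G by (simp add: simple_graph_def)
  define A where "A = adj E"
  have A0: "A v v = 0" for v by (simp add: A_def adj_def)
  define Q where "Q y = (\<Sum>u\<in>V. \<Sum>v\<in>V. A u v * y u * y v)" for y :: "'a \<Rightarrow> real"
  define N where "N y = (\<Sum>v\<in>V. (y v)\<^sup>2)" for y :: "'a \<Rightarrow> real"
  define f where "f y = - Q y - l * N y" for y
  define B where "B = {x :: 'a \<Rightarrow> real. \<forall>i. (i \<in> V \<longrightarrow> -1 \<le> x i \<and> x i \<le> 1) \<and> (i \<notin> V \<longrightarrow> x i = 0)}"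
  have cpt: "compact B" unfolding B_def by (rule compact_unit_box)
  have coord: "continuous_on S (\<lambda>q :: 'a \<Rightarrow> real. q k)" for k S
    by (rule continuous_on_subset[OF continuous_on_product_coordinates]) simp
  have "continuous_on B f" unfolding f_def Q_def N_def by (intro continuous_intros coord)
  moreover have zero: "(\<lambda>_. 0) \<in> B" by (simp add: B_def)
  ultimately obtain x where x: "x \<in> B" and xmax: "\<And>y. y \<in> B \<Longrightarrow> f y \<le> f x"
    using continuous_attains_sup[OF cpt, of f] by blast
  have xb: "\<bar>x v\<bar> \<le> 1" if "v \<in> V" for v using x that by (auto simp: B_def abs_le_iff minus_le_iff)
  define U where "U = {v \<in> V. \<bar>x v\<bar> < 1}"
  have "real (card (V - U)) = (\<Sum>v\<in>V - U. (x v)\<^sup>2)"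
  proof -
    have "(x v)\<^sup>2 = 1" if "v \<in> V - U" for v
    proof -
      have "\<bar>x v\<bar> = 1" using that xb[of v] by (auto simp: U_def)
      then show ?thesis by (metis one_power2 power2_abs)
    qed
    then show ?thesis by simp
  qed
  also have "\<dots> \<le> N x" unfolding N_def using fin by (intro sum_mono2) auto
  finally have "l * real (card (V - U)) \<le> l * N x" using l by simp
  \<comment> \<open>The zero vector competes with value 0. Rounding \<open>x\<close> to signs then
    brings in the surplus.\<close>
  also have "\<dots> \<le> - Q x" using xmax[OF zero] by (simp add: f_def Q_def N_def)
  also have "\<dots> \<le> 4 * sp V E"
  proof -
    obtain \<epsilon> where "\<And>v. v \<in> V \<Longrightarrow> \<epsilon> v = 1 \<or> \<epsilon> v = -1" "Q \<epsilon> \<le> Q x"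
      using quadratic_form_ge_sign_vector[of V A x] fin A0 xb unfolding Q_def by blast
    then show ?thesis using sign_form_ge_surplus[OF G, of \<epsilon>] by (simp add: Q_def A_def)
  qed
  finally have card: "l * real (card (V - U)) \<le> 4 * sp V E" .
  have "psd_on U (\<lambda>x y. A x y + l * of_bool (x = y))"
    unfolding psd_on_def
  proof
    fix y :: "'a \<Rightarrow> real"
    define y' where "y' v = (if v \<in> U then y v else 0)" for v
    \<comment> \<open>A step small enough to stay in the cube in both directions.
      \<open>1 + \<bar>y v\<bar>\<close> avoids division by 0, and the inserted 1 keeps the set
      nonempty if \<open>U\<close> is empty.\<close>
    define t where "t = Min (insert 1 ((\<lambda>v. (1 - \<bar>x v\<bar>) / (1 + \<bar>y v\<bar>)) ` U))"
    have finU: "finite U" "U \<subseteq> V" using fin by (auto simp: U_def)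
    have t0: "0 < t" unfolding t_def using finU by (subst Min_gr_iff) (auto simp: U_def intro!: divide_pos_pos)
    have tle: "t * \<bar>y v\<bar> \<le> 1 - \<bar>x v\<bar>" if "v \<in> U" for v
    proof -
      have "t \<le> (1 - \<bar>x v\<bar>) / (1 + \<bar>y v\<bar>)" unfolding t_def using finU that by (intro Min_le) auto
      then have "t * (1 + \<bar>y v\<bar>) \<le> 1 - \<bar>x v\<bar>" by (simp add: pos_le_divide_eq)
      then show ?thesis using t0 by (simp add: distrib_left)
    qed
    have inB: "(\<lambda>v. x v + c * y' v) \<in> B" if "\<bar>c\<bar> = t" for c
    proof -
      have "\<bar>x v + c * y' v\<bar> \<le> 1" if "v \<in> V" for v
      proof (cases "v \<in> U")
        case True
        have "\<bar>x v + c * y' v\<bar> \<le> \<bar>x v\<bar> + \<bar>c\<bar> * \<bar>y' v\<bar>" by (metis abs_mult abs_triangle_ineq)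
        then show ?thesis using tle[OF True] True \<open>\<bar>c\<bar> = t\<close> by (simp add: y'_def)
      next
        case False
        then show ?thesis using xb[OF that] by (simp add: y'_def)
      qed
      moreover have "x v + c * y' v = 0" if "v \<notin> V" for v
        using that x finU by (auto simp: B_def y'_def)
      moreover have "-1 \<le> x v + c * y' v \<and> x v + c * y' v \<le> 1" if "\<bar>x v + c * y' v\<bar> \<le> 1" for v
        using that by linarith
      ultimately show ?thesis by (simp add: B_def)
    qed
    \<comment> \<open>Adding both directions cancels the linear terms and leaves the second order
      condition.\<close>
    have "Q (\<lambda>v. x v + t * y' v) + Q (\<lambda>v. x v + (-t) * y' v) = 2 * Q x + 2 * t\<^sup>2 * Q y'"
      unfolding Q_def sum_distrib_left sum.distrib[symmetric]
      by (intro sum.cong refl) (simp add: algebra_simps power2_eq_square)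
    moreover have "N (\<lambda>v. x v + t * y' v) + N (\<lambda>v. x v + (-t) * y' v) = 2 * N x + 2 * t\<^sup>2 * N y'"
      unfolding N_def sum_distrib_left sum.distrib[symmetric]
      by (intro sum.cong refl) (simp add: algebra_simps power2_eq_square)
    then have "l * N (\<lambda>v. x v + t * y' v) + l * N (\<lambda>v. x v + (-t) * y' v) = 2 * (l * N x) + 2 * t\<^sup>2 * (l * N y')"
      unfolding distrib_left[symmetric] by (simp add: algebra_simps)
    moreover have "f (\<lambda>v. x v + t * y' v) \<le> f x" "f (\<lambda>v. x v + (-t) * y' v) \<le> f x"
      using t0 by (intro xmax inB; simp)+
    ultimately have "0 \<le> 2 * t\<^sup>2 * Q y' + 2 * t\<^sup>2 * (l * N y')" unfolding f_def by linarith
    then have "0 \<le> 2 * t\<^sup>2 * (Q y' + l * N y')" by (simp add: distrib_left)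
    then have pos: "0 \<le> Q y' + l * N y'" using t0 by (simp add: zero_le_mult_iff)
    have "Q y' = (\<Sum>u\<in>U. \<Sum>v\<in>U. A u v * y u * y v)"
      unfolding Q_def
    proof (rule sum.mono_neutral_cong_right)
      fix u assume "u \<in> U"
      then show "(\<Sum>v\<in>V. A u v * y' u * y' v) = (\<Sum>v\<in>U. A u v * y u * y v)"
        using fin finU by (intro sum.mono_neutral_cong_right) (auto simp: y'_def)
    qed (use fin finU in \<open>auto simp: y'_def\<close>)
    moreover have "N y' = (\<Sum>u\<in>U. (y u)\<^sup>2)"
      unfolding N_def using fin finU by (intro sum.mono_neutral_cong_right) (auto simp: y'_def)
    moreover have "(\<Sum>v\<in>U. of_bool (u = v) * y u * y v) = (y u)\<^sup>2" if "u \<in> U" for u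
    proof -
      have "(\<Sum>v\<in>U. of_bool (u = v) * y u * y v) = (\<Sum>v\<in>U. if v = u then (y u)\<^sup>2 else 0)"
        by (intro sum.cong) (auto simp: power2_eq_square)
      then show ?thesis using finU that by simp
    qed
    ultimately have "Q y' + l * N y' = (\<Sum>u\<in>U. (\<Sum>v\<in>U. A u v * y u * y v) + l * (\<Sum>v\<in>U. of_bool (u = v) * y u * y v))"
      by (simp add: sum.distrib sum_distrib_left)
    also have "\<dots> = (\<Sum>u\<in>U. \<Sum>v\<in>U. (A u v + l * of_bool (u = v)) * y u * y v)"
      unfolding sum_distrib_left sum.distrib[symmetric] by (intro sum.cong refl) (simp add: algebra_simps)
    finally show "0 \<le> (\<Sum>u\<in>U. \<Sum>v\<in>U. (A u v + l * of_bool (u = v)) * y u * y v)" using pos by simp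
  qed
  then show ?thesis using that[of U] card by (auto simp: A_def U_def)
qed

section \<open>Extremal subgraphs\<close>

lemma weight_remove:
  assumes "finite S" "x \<in> S" "A x x = 0" "\<And>y. y \<in> S \<Longrightarrow> A x y = A y x"
  shows "weight A (S - {x}) = weight A S - 2 * (\<Sum>y\<in>S. A x y)"
proof -
  have rem: "(\<Sum>y\<in>S. g y) = g x + (\<Sum>y\<in>S - {x}. g y)" for g :: "'a \<Rightarrow> real"
    using assms(1,2) by (rule sum.remove)
  have "weight A S = (\<Sum>y\<in>S. A x y) + (\<Sum>z\<in>S - {x}. A z x + (\<Sum>y\<in>S - {x}. A z y))"
    unfolding weight_def rem[of "\<lambda>z. \<Sum>y\<in>S. A z y"] by (intro arg_cong2[where f = "(+)"] refl sum.cong rem)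
  also have "\<dots> = (\<Sum>y\<in>S. A x y) + ((\<Sum>z\<in>S - {x}. A z x) + weight A (S - {x}))"
    by (simp add: sum.distrib weight_def)
  also have "(\<Sum>z\<in>S - {x}. A z x) = (\<Sum>y\<in>S. A x y)"
    unfolding rem[of "A x"] assms(3) using assms(4) by (auto intro!: sum.cong)
  finally show ?thesis by simp
qed

lemma one_minus_power7_le:
  fixes h :: real assumes "0 \<le> h" "h \<le> 1"
  shows "(1 - h)^7 \<le> 1 - 7 * h + 21 * h\<^sup>2"
proof -
  have "1 - 7 * h + 21 * h\<^sup>2 - (1 - h)^7 = 35 * h^3 * (1 - h) + h^5 * (14 + 7 * (1 - h) + h\<^sup>2)"
    by (simp add: power_numeral_reduce algebra_simps)
  also have "\<dots> \<ge> 0" using assms by (intro add_nonneg_nonneg mult_nonneg_nonneg) auto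
  finally show ?thesis by simp
qed

text \<open>Deleting a vertex of low degree would increase \<open>weight\<^sup>4 / size\<^sup>7\<close>; the constant \<open>874/1000\<close> is slightly
  below the limiting value \<open>7/8\<close>.\<close>

lemma extremal_degree_ge:
  assumes fin: "finite S" and x: "x \<in> S" and "A x x = 0" "\<And>y. y \<in> S \<Longrightarrow> A x y = A y x"
    and pos: "0 < weight A S" and big: "3000 \<le> card S"
    and ext: "weight A (S - {x}) ^ 4 / real (card (S - {x})) ^ 7 \<le> weight A S ^ 4 / real (card S) ^ 7"
  shows "874/1000 * (weight A S / (real (card S))\<^sup>2) * real (card S) \<le> (\<Sum>y\<in>S. A x y)"
proof (rule ccontr)
  define s where "s = real (card S)"
  define D where "D = weight A S"
  define d where "d = (\<Sum>y\<in>S. A x y)"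
  define h where "h = 1 / s"
  have s: "3000 \<le> s" using big by (simp add: s_def)
  have h: "0 < h" "h \<le> 1/3000" using s by (auto simp: h_def field_simps)
  have D0: "0 < D" using pos by (simp add: D_def)
  assume "\<not> ?thesis"
  then have d: "d < 874/1000 * D * h"
    using s by (simp add: s_def[symmetric] D_def[symmetric] d_def[symmetric] h_def power2_eq_square)
  have card': "real (card (S - {x})) = s * (1 - h)"
    using fin x s by (auto simp: s_def h_def right_diff_distrib of_nat_diff card_gt_0_iff Suc_leI)
  \<comment> \<open>\<open>h\<close> is the relative loss in size; a degree below the bound leaves
    more than the fraction \<open>1 - 1748/1000 * h\<close> of the weight.\<close>
  have "D * (1 - 1748/1000 * h) \<le> D - 2 * d" using d by (simp add: algebra_simps)
  then have "(D * (1 - 1748/1000 * h)) ^ 4 \<le> (D - 2 * d) ^ 4"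
    using D0 h by (intro power_mono) auto
  also have "D - 2 * d = weight A (S - {x})"
    using weight_remove[of S x A, OF fin x assms(3,4)] by (simp add: D_def d_def)
  finally have "(D * (1 - 1748/1000 * h)) ^ 4 / (s * (1 - h)) ^ 7 \<le> weight A (S - {x}) ^ 4 / (s * (1 - h)) ^ 7"
    using s h by (intro divide_right_mono) auto
  also have "\<dots> \<le> D ^ 4 / s ^ 7" using ext unfolding card' by (simp add: s_def D_def)
  finally have "(D * (1 - 1748/1000 * h)) ^ 4 \<le> D ^ 4 / s ^ 7 * (s * (1 - h)) ^ 7"
    using s h by (subst (asm) pos_divide_le_eq) auto
  also have "\<dots> = D ^ 4 * (1 - h) ^ 7" using s by (simp add: power_mult_distrib)
  finally have "(1 - 1748/1000 * h) ^ 4 \<le> (1 - h) ^ 7"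
    using D0 by (simp add: power_mult_distrib)
  \<comment> \<open>The slopes are \<open>4 * 1748/1000 = 6992/1000\<close> and 7; the gap
    \<open>8/1000\<close> exceeds \<open>21 * h\<close> because
    \<open>h \<le> 1/3000\<close>.\<close>
  moreover have "1 + 4 * (- (1748/1000 * h)) \<le> (1 + (- (1748/1000 * h))) ^ 4"
    using Bernoulli_inequality[of "- (1748/1000 * h)" 4] h by simp
  moreover have "(1 - h) ^ 7 \<le> 1 - 7 * h + 21 * h\<^sup>2" using h by (intro one_minus_power7_le) auto
  ultimately have "8/1000 * h \<le> (21 * h) * h" by (simp add: power2_eq_square)
  then have "8/1000 \<le> 21 * h" using h(1) by (rule mult_right_le_imp_le)
  then show False using h by simp
qed

text \<open>Extremality enters twice: against \<open>S - {x}\<close> it bounds degrees below,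
  against a neighbourhood it bounds \<open>codeg\<close> above.\<close>

lemma extremal_subgraph_nearly_complete:
  fixes A :: "'a \<Rightarrow> 'a \<Rightarrow> real" and l s p :: real
  assumes fin: "finite U" and sym: "\<And>x y. A x y = A y x" and zero_one: "\<And>x y. A x y = 0 \<or> A x y = 1"
    and no_loops: "\<And>x. A x x = 0" and psd: "psd_on U (\<lambda>x y. A x y + l * of_bool (x = y))" and l: "1 < l"
    and S: "S \<subseteq> U" "S \<noteq> {}"
    and ext: "\<And>T. T \<subseteq> U \<Longrightarrow> T \<noteq> {} \<Longrightarrow> weight A T ^ 4 / real (card T) ^ 7 \<le> weight A S ^ 4 / real (card S) ^ 7"
    and s: "s = real (card S)" and p: "p = weight A S / s\<^sup>2" and p0: "0 < p" and big: "3000 \<le> s"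
    and l1: "l\<^sup>2 * sqrt s / s \<le> 1/1000" and l2: "l \<le> sqrt s powr (1/200)"
    and l3: "l\<^sup>2 / s \<le> 4/10000 * p" and l4: "l^3 / (874/1000 * p * s)\<^sup>2 \<le> p / 1000"
    and l5: "l / s \<le> p / 1000"
  shows "1 - p \<le> 20000 * l^13 / s"
proof -
  have finS: "finite S" using fin S by (meson finite_subset)
  obtain \<phi> \<alpha> where *:
    "\<And>i j. i \<in> S \<Longrightarrow> j \<in> S \<Longrightarrow> (\<Sum>x\<in>S. \<phi> i x * \<phi> j x) = of_bool (i = j)"
    "\<And>x y. x \<in> S \<Longrightarrow> y \<in> S \<Longrightarrow> (\<Sum>i\<in>S. \<phi> i x * \<phi> i y) = of_bool (x = y)"
    "\<And>i x. i \<in> S \<Longrightarrow> x \<in> S \<Longrightarrow> (\<Sum>y\<in>S. A x y * \<phi> i y) = \<alpha> i * \<phi> i x"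
    using spectral_decomposition[OF finS, of A] sym by blast
  have "psd_on S (\<lambda>x y. A x y + l * of_bool (x = y))" by (rule psd_on_subset[OF psd S(1) fin])
  then interpret near_psd_graph S A \<phi> \<alpha> l
    by unfold_locales (use finS * zero_one no_loops l S in \<open>auto intro: sym\<close>)
  have p_eq: "p = density" by (simp add: p density_def deg_def weight_def s)
  have D0: "0 < weight A S" using p0 big by (auto simp: p zero_less_divide_iff)
  have degree: "874/1000 * p * s \<le> deg x" if "x \<in> S" for x
  proof -
    have "card (S - {x}) \<noteq> 0" using that big s finS by simp
    then have "S - {x} \<noteq> {}" by (metis card.empty)
    then show ?thesis
      using extremal_degree_ge[of S x A] finS that no_loops sym D0 big ext[of "S - {x}"] S
      by (simp add: deg_def s p subset_insertI2 Diff_subset[THEN subset_trans])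
  qed
  have codegree: "codeg v ^ 4 \<le> p^4 * s * deg v ^ 7" if v: "v \<in> S" for v
  proof -
    \<comment> \<open>The neighbourhood has size \<open>deg v\<close> and weight
      \<open>codeg v\<close>, and the extremal quantity equals \<open>p^4 * s\<close> at
      \<open>S\<close>.\<close>
    define N where "N = {x \<in> S. A v x = 1}"
    have ind: "A v x = of_bool (x \<in> N)" if "x \<in> S" for x
      using zero_one[of v x] that v by (auto simp: N_def)
    have N: "N \<subseteq> S" "finite N" using finS by (auto simp: N_def)
    have "deg v = (\<Sum>x\<in>S. of_bool (x \<in> N))" unfolding deg_def by (intro sum.cong refl ind)
    also have "\<dots> = real (card N)" using N finS by (simp add: Int_absorb1)
    finally have dN: "deg v = real (card N)" .
    have "codeg v = (\<Sum>x\<in>S. \<Sum>y\<in>S. A x y * of_bool (x \<in> N) * of_bool (y \<in> N))"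
      unfolding codeg_def by (intro sum.cong refl) (simp add: ind)
    also have "\<dots> = (\<Sum>x\<in>N. \<Sum>y\<in>N. A x y)"
    proof (rule sum.mono_neutral_cong_right)
      fix x assume "x \<in> N"
      then show "(\<Sum>y\<in>S. A x y * of_bool (x \<in> N) * of_bool (y \<in> N)) = (\<Sum>y\<in>N. A x y)"
        using N finS by (intro sum.mono_neutral_cong_right) auto
    qed (use N finS in auto)
    finally have cN: "codeg v = weight A N" by (simp add: weight_def)
    show ?thesis
    proof (cases "N = {}")
      case True
      then show ?thesis by (simp add: cN dN weight_def)
    next
      case False
      then have c0: "0 < real (card N)" using N by (simp add: card_gt_0_iff)
      have "weight A N ^ 4 / real (card N) ^ 7 \<le> weight A S ^ 4 / s ^ 7"
        using ext[of N] False N S by (auto simp: s)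
      also have "\<dots> = p^4 * s" using big by (simp add: p field_simps power_numeral_reduce)
      finally show ?thesis using c0 by (simp add: cN dN pos_divide_le_eq)
    qed
  qed
  have "72/100 \<le> p"
    using density_ge degree codegree p0 l1 l2 l3 l4 unfolding p_eq s by blast
  then show ?thesis
    using density_close_to_one degree l5 unfolding p_eq s by blast
qed

text \<open>Each point of \<open>V - U\<close> accounts for at most \<open>2 * card V\<close>
  ordered pairs.\<close>

lemma weight_restrict_ge:
  assumes "finite V" "U \<subseteq> V" "\<And>x y. A x y \<le> 1"
  shows "weight A V - 2 * real (card V) * real (card (V - U)) \<le> weight A U"
proof -
  have bound: "(\<Sum>x\<in>X. \<Sum>y\<in>Y. A x y) \<le> real (card X) * real (card Y)" for X Y
  proof -
    have "(\<Sum>x\<in>X. \<Sum>y\<in>Y. A x y) \<le> (\<Sum>x\<in>X. \<Sum>y\<in>Y. 1)" by (intro sum_mono assms)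
    then show ?thesis by simp
  qed
  have split: "(\<Sum>x\<in>V. g x) = (\<Sum>x\<in>U. g x) + (\<Sum>x\<in>V - U. g x)" for g :: "'a \<Rightarrow> real"
    using sum.subset_diff[OF assms(2,1), of g] by simp
  have "weight A V = (\<Sum>x\<in>U. (\<Sum>y\<in>U. A x y) + (\<Sum>y\<in>V - U. A x y)) + (\<Sum>x\<in>V - U. \<Sum>y\<in>V. A x y)"
    unfolding weight_def split[of "\<lambda>x. \<Sum>y\<in>V. A x y"] by (simp only: split)
  also have "\<dots> = weight A U + (\<Sum>x\<in>U. \<Sum>y\<in>V - U. A x y) + (\<Sum>x\<in>V - U. \<Sum>y\<in>V. A x y)"
    by (simp add: sum.distrib weight_def)
  also have "\<dots> \<le> weight A U + real (card U) * real (card (V - U)) + real (card (V - U)) * real (card V)"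
    by (intro add_mono bound order_refl)
  also have "real (card U) * real (card (V - U)) \<le> real (card V) * real (card (V - U))"
    using card_mono[OF assms(1,2)] by (intro mult_right_mono) auto
  finally show ?thesis by (simp add: algebra_simps)
qed

lemma obtain_extremal_subset:
  fixes f :: "'a set \<Rightarrow> real"
  assumes "finite U" "U \<noteq> {}"
  obtains S where "S \<subseteq> U" "S \<noteq> {}" "\<And>T. T \<subseteq> U \<Longrightarrow> T \<noteq> {} \<Longrightarrow> f T \<le> f S"
proof -
  define X where "X = {T. T \<subseteq> U \<and> T \<noteq> {}}"
  have X: "finite X" "X \<noteq> {}" using assms by (auto simp: X_def)
  then have "Max (f ` X) \<in> f ` X" by (intro Max_in) auto
  then obtain S where "S \<in> X" "f S = Max (f ` X)" by auto
  then show ?thesis using that[of S] X by (auto simp: X_def)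
qed

section \<open>Parameters and asymptotics\<close>

theorem theorem1p7:
  fixes \<rho> :: real
  assumes "\<rho> = 1 / 1000"
  shows "\<forall>\<epsilon>::real. \<epsilon> > 0 \<longrightarrow> (\<exists>n\<^sub>0::nat. \<forall>n\<ge>n\<^sub>0. \<forall>(V :: 'a set) (E :: 'a set set).
           simple_graph V E \<and> card V = n \<and> real (card E) \<ge> real n powr (2 - \<rho>) \<and>
           sp V E \<le> real n powr (1 + \<rho>) \<longrightarrow>
           (\<exists>W F. induced_subgraph W F V E \<and> real (card W) \<ge> real n powr (1 - 4 * \<rho>) \<and>
              edge_density W F \<ge> 1 - \<epsilon>))"
proof (intro allI impI)
  fix \<epsilon> :: real assume \<epsilon>: "0 < \<epsilon>"
  \<comment> \<open>\<open>a n = n^(1 - 4\<rho>)\<close> and \<open>b n = n^(-\<rho>)\<close> will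
    be lower bounds for size and density of the extremal set, so every smallness condition on
    \<open>l = L n\<close> is first checked with them.\<close>
  define L where "L n = 8 * real n powr (1/500)" for n
  define a where "a n = real n powr (249/250)" for n
  define b where "b n = real n powr (-1/1000)" for n
  have "eventually (\<lambda>n. 1 < L n) at_top" unfolding L_def by real_asymp
  moreover have "eventually (\<lambda>n. 3000 \<le> a n) at_top" unfolding a_def by real_asymp
  moreover have "eventually (\<lambda>n. (L n)\<^sup>2 / sqrt (a n) \<le> 1/1000) at_top" unfolding a_def L_def by real_asymp
  \<comment> \<open>The narrowest comparison of exponents: \<open>249/250 / 400 = 0.00249\<close>
    against \<open>1/500\<close>.\<close>
  moreover have "eventually (\<lambda>n. L n \<le> a n powr (1/400)) at_top"
    unfolding a_def L_def powr_powr by simp real_asymp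
  moreover have "eventually (\<lambda>n. (L n)\<^sup>2 / a n \<le> 4/10000 * b n) at_top" unfolding a_def b_def L_def by real_asymp
  moreover have "eventually (\<lambda>n. (L n)^3 / (874/1000 * b n * a n)\<^sup>2 \<le> b n / 1000) at_top" unfolding a_def b_def L_def by real_asymp
  moreover have "eventually (\<lambda>n. L n / a n \<le> b n / 1000) at_top" unfolding a_def b_def L_def by real_asymp
  moreover have "eventually (\<lambda>n. 20000 * (L n)^13 / a n < \<epsilon>) at_top"
  proof (rule order_tendstoD(2)[OF _ \<epsilon>])
    show "(\<lambda>n. 20000 * (L n)^13 / a n) \<longlonglongrightarrow> 0" unfolding a_def L_def by real_asymp
  qed
  ultimately have "eventually (\<lambda>n. n \<ge> 1 \<and> 1 < L n \<and> 3000 \<le> a n \<and> (L n)\<^sup>2 / sqrt (a n) \<le> 1/1000 \<and> L n \<le> a n powr (1/400)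
      \<and> (L n)\<^sup>2 / a n \<le> 4/10000 * b n \<and> (L n)^3 / (874/1000 * b n * a n)\<^sup>2 \<le> b n / 1000 \<and> L n / a n \<le> b n / 1000
      \<and> 20000 * (L n)^13 / a n < \<epsilon>) at_top"
    using eventually_ge_at_top[of "1::nat"] by eventually_elim blast
  then obtain n0 where n0: "\<And>n. n \<ge> n0 \<Longrightarrow> n \<ge> 1 \<and> 1 < L n \<and> 3000 \<le> a n \<and> (L n)\<^sup>2 / sqrt (a n) \<le> 1/1000 \<and> L n \<le> a n powr (1/400)
      \<and> (L n)\<^sup>2 / a n \<le> 4/10000 * b n \<and> (L n)^3 / (874/1000 * b n * a n)\<^sup>2 \<le> b n / 1000 \<and> L n / a n \<le> b n / 1000
      \<and> 20000 * (L n)^13 / a n < \<epsilon>"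
    unfolding eventually_at_top_linorder by blast
  show "\<exists>n\<^sub>0::nat. \<forall>n\<ge>n\<^sub>0. \<forall>(V :: 'a set) (E :: 'a set set).
           simple_graph V E \<and> card V = n \<and> real (card E) \<ge> real n powr (2 - \<rho>) \<and>
           sp V E \<le> real n powr (1 + \<rho>) \<longrightarrow>
           (\<exists>W F. induced_subgraph W F V E \<and> real (card W) \<ge> real n powr (1 - 4 * \<rho>) \<and>
              edge_density W F \<ge> 1 - \<epsilon>)"
  proof (intro exI[of _ n0] allI impI, elim conjE)
    fix n and V :: "'a set" and E :: "'a set set"
    assume n: "n0 \<le> n" and G: "simple_graph V E" and card_V: "card V = n"
      and edges: "real n powr (2 - \<rho>) \<le> real (card E)" and surplus: "sp V E \<le> real n powr (1 + \<rho>)"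
    define l where "l = L n"
    note N = n0[OF n, folded l_def]
    have n_pos: "0 < real n" using N by simp
    have fin: "finite V" using G by (simp add: simple_graph_def)
    define A where "A = adj E"
    have A01: "A x y = 0 \<or> A x y = 1" for x y by (simp add: A_def adj_def)
    have A_le: "A x y \<le> 1" "0 \<le> A x y" for x y by (simp_all add: A_def adj_def)
    obtain U where U: "U \<subseteq> V" "psd_on U (\<lambda>x y. A x y + l * of_bool (x = y))"
      and del: "l * real (card (V - U)) \<le> 4 * sp V E"
      using psd_after_deletion[OF G, of l] N unfolding A_def by auto
    have finU: "finite U" using U fin by (meson finite_subset)
    have "weight A V = 2 * real (card E)"
    proof -
      have "{e \<in> E. e \<subseteq> V} = E" using G by (auto simp: simple_graph_def)
      then show ?thesis using weight_adj[OF G subset_refl] by (simp add: A_def)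
    qed
    \<comment> \<open>This is why \<open>L\<close> has the factor 8: deletion costs at most half of
      the guaranteed weight \<open>2 * n powr (2 - \<rho>)\<close>.\<close>
    moreover have "2 * real n * real (card (V - U)) \<le> real n powr (2 - \<rho>)"
    proof -
      have "l * (2 * real n * real (card (V - U))) = 2 * real n * (l * real (card (V - U)))" by simp
      also have "\<dots> \<le> 2 * real n * (4 * real n powr (1 + \<rho>))"
        using del surplus by (intro mult_left_mono) auto
      also have "\<dots> = 8 * (real n powr 1 * real n powr (1 + \<rho>))" using n_pos by simp
      also have "\<dots> = 8 * (real n powr (1/500) * real n powr (2 - \<rho>))"
        unfolding powr_add[symmetric] assms by simp
      also have "\<dots> = l * real n powr (2 - \<rho>)" by (simp add: l_def L_def)
      finally show ?thesis using N by simp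
    qed
    ultimately have wU: "real n powr (2 - \<rho>) \<le> weight A U"
      using weight_restrict_ge[OF fin U(1), of A] A_le edges card_V by simp
    have "0 < real n powr (2 - \<rho>)" using n_pos by simp
    then have "0 < weight A U" using wU by linarith
    then have "U \<noteq> {}" by (auto simp: weight_def)
    then obtain S where S: "S \<subseteq> U" "S \<noteq> {}"
      and ext: "\<And>T. T \<subseteq> U \<Longrightarrow> T \<noteq> {} \<Longrightarrow> weight A T ^ 4 / real (card T) ^ 7 \<le> weight A S ^ 4 / real (card S) ^ 7"
      using obtain_extremal_subset[OF finU, of "\<lambda>T. weight A T ^ 4 / real (card T) ^ 7"] by blast
    define s where "s = real (card S)"
    define p where "p = weight A S / s\<^sup>2"
    have finS: "finite S" using S finU by (meson finite_subset)
    have s0: "0 < s" using S finS by (simp add: s_def card_gt_0_iff)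
    have wS0: "0 \<le> weight A S" unfolding weight_def by (intro sum_nonneg A_le)
    have p0: "0 \<le> p" using wS0 by (simp add: p_def)
    have p1: "p \<le> 1"
    proof -
      have "weight A S \<le> (\<Sum>x\<in>S. \<Sum>y\<in>S. 1)" unfolding weight_def by (intro sum_mono A_le)
      then show ?thesis using s0 by (simp add: p_def s_def power2_eq_square)
    qed
    \<comment> \<open>The exponents 4 and 7 pay off here: at \<open>U\<close> the extremal quantity
      is at least \<open>n^(4 * (2 - \<rho>) - 7) = n^(1 - 4\<rho>)\<close>, and at \<open>S\<close>
      it is \<open>p^4 * s \<le> s\<close>.\<close>
    have le: "real n powr (1 - 4 * \<rho>) \<le> p^4 * s"
    proof -
      have "real n powr (1 - 4 * \<rho>) = (real n powr (2 - \<rho>)) powr 4 / real n powr 7"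
        unfolding powr_powr powr_diff[symmetric] by (simp add: mult.commute)
      also have "\<dots> = (real n powr (2 - \<rho>)) ^ 4 / real n ^ 7" using n_pos by simp
      also have "\<dots> \<le> weight A U ^ 4 / real (card U) ^ 7"
        using wU card_mono[OF fin U(1)] card_V \<open>U \<noteq> {}\<close> finU
        by (intro frac_le power_mono) (auto simp: card_gt_0_iff)
      also have "\<dots> \<le> weight A S ^ 4 / s ^ 7" using ext[of U] \<open>U \<noteq> {}\<close> by (simp add: s_def)
      also have "\<dots> = p^4 * s" using s0 by (simp add: p_def field_simps power_numeral_reduce)
      finally show ?thesis .
    qed
    have "p^4 * s \<le> 1 * s" using p0 p1 s0 by (intro mult_right_mono power_le_one) auto
    then have s_ge: "real n powr (1 - 4 * \<rho>) \<le> s" using le by simp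
    then have s_ge': "a n \<le> s" by (simp add: a_def assms)
    \<comment> \<open>With \<open>s \<le> n\<close> the same inequality gives
      \<open>p^4 \<ge> n^(-4\<rho>)\<close>.\<close>
    have p_ge: "b n \<le> p"
    proof (rule power_le_imp_le_base[of _ 3])
      have "card S \<le> n" using card_mono[OF fin, of S] S U card_V by auto
      then have "p^4 * s \<le> p^4 * real n" using p0 by (intro mult_left_mono) (auto simp: s_def)
      then have "real n powr (1 - 4 * \<rho>) / real n \<le> p^4" using le n_pos by (simp add: pos_divide_le_eq)
      moreover have "real n powr (1 - 4 * \<rho>) / real n = b n ^ 4"
      proof -
        have "real n powr (1 - 4 * \<rho>) / real n = real n powr (1 - 4 * \<rho>) / real n powr 1" using n_pos by simp
        also have "\<dots> = real n powr (- 4 / 1000)" unfolding powr_diff[symmetric] assms by simp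
        also have "\<dots> = (b n) powr 4" unfolding b_def powr_powr by simp
        also have "\<dots> = b n ^ 4" using n_pos by (simp add: b_def)
        finally show ?thesis .
      qed
      ultimately show "b n ^ Suc 3 \<le> p ^ Suc 3" by simp
    qed (rule p0)
    have b0: "0 < b n" using n_pos by (simp add: b_def)
    have a0: "0 < a n" using N by simp
    have l0: "1 < l" using N by simp
    have anti: "c / s \<le> c / a n" if "0 \<le> c" for c
      using that s_ge' a0 s0 by (intro divide_left_mono) auto
    have "1 - p \<le> 20000 * l^13 / s"
    proof (rule extremal_subgraph_nearly_complete[OF finU _ A01 _ U(2) l0 S ext s_def p_def])
      show "A x y = A y x" for x y by (simp add: A_def adj_commute)
      show "A x x = 0" for x by (simp add: A_def adj_def)
      show "0 < p" using b0 p_ge by linarith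
      show "3000 \<le> s" using N s_ge' by linarith
      have "l\<^sup>2 * sqrt s / s = l\<^sup>2 / sqrt s" using s0 by (metis mult.commute real_div_sqrt times_divide_eq_left divide_divide_eq_right less_imp_le)
      also have "\<dots> \<le> l\<^sup>2 / sqrt (a n)" using s_ge' a0 by (intro divide_left_mono) auto
      finally show "l\<^sup>2 * sqrt s / s \<le> 1/1000" using N by linarith
      have "a n powr (1/400) \<le> s powr (1/400)" using s_ge' a0 by (intro powr_mono2) auto
      also have "\<dots> = sqrt s powr (1/200)" using s0 by (simp add: powr_powr flip: powr_half_sqrt)
      finally show "l \<le> sqrt s powr (1/200)" using N by linarith
      have "l\<^sup>2 / s \<le> l\<^sup>2 / a n" by (intro anti) simp
      then show "l\<^sup>2 / s \<le> 4/10000 * p" using N p_ge by linarith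
      have "874/1000 * b n * a n \<le> 874/1000 * p * s" using p_ge s_ge' b0 a0 p0 by (intro mult_mono) auto
      then have "l^3 / (874/1000 * p * s)\<^sup>2 \<le> l^3 / (874/1000 * b n * a n)\<^sup>2"
        using a0 b0 l0 s0 p_ge by (intro divide_left_mono power_mono mult_pos_pos zero_less_power) auto
      then show "l^3 / (874/1000 * p * s)\<^sup>2 \<le> p / 1000" using N p_ge by linarith
      have "l / s \<le> l / a n" using l0 by (intro anti) simp
      then show "l / s \<le> p / 1000" using N p_ge by linarith
    qed
    also have "\<dots> \<le> 20000 * l^13 / a n" using l0 by (intro anti) auto
    finally have dense: "1 - \<epsilon> \<le> p" using N by linarith
    have "S \<subseteq> V" using S U by auto
    then have "edge_density S {e \<in> E. e \<subseteq> S} = p"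
      using weight_adj[OF G, of S] by (simp add: edge_density_def p_def s_def A_def)
    moreover have "induced_subgraph S {e \<in> E. e \<subseteq> S} V E" using \<open>S \<subseteq> V\<close> by (simp add: induced_subgraph_def)
    ultimately show "\<exists>W F. induced_subgraph W F V E \<and> real n powr (1 - 4 * \<rho>) \<le> real (card W) \<and> 1 - \<epsilon> \<le> edge_density W F"
      using dense s_ge s_def by metis
  qed
qed

end
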